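(* Let $F\in C^1(\mathbb{R}^2,\mathbb{R}^2)$ with $D(x,y) = 1$ for all $(x,y)\in\mathbb{R}^2$. If the function $T:\mathbb{R}^2\to\mathbb{R}$ is not surjective, then $F$ is injective.
   Context: For $F=(P,Q)\in C^1(\mathbb{R}^2,\mathbb{R}^2)$, $J_F(x,y)=\begin{pmatrix}P_x & P_y\\ Q_x & Q_y\end{pmatrix}(x,y)$ is the Jacobian matrix, $T(x,y)=P_x(x,y)+Q_y(x,y)$ its trace, and $D(x,y)=\det J_F(x,y)$ its determinant. *)

theory Defs
  imports "HOL-Analysis.Analysis"
begin

(* The library's C1_differentiable_on only covers functions of one real variable. *)
definition C1_map :: "(real ^ 2 \<Rightarrow> real ^ 2) \<Rightarrow> bool" where
  "C1_map F \<longleftrightarrow> (\<forall>p. F differentiable (at p)) \<and> continuous_on UNIV (\<lambda>p. jacobian F (at p))"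

lemma jacobian_partial_derivative:
  assumes "F differentiable (at p)"
  shows "((\<lambda>t. F (p + t *\<^sub>R axis j 1) $ i) has_real_derivative jacobian F (at p) $ i $ j) (at 0)"
proof -
  have "(F has_derivative frechet_derivative F (at p)) (at (p + 0 *\<^sub>R axis j 1))"
    using assms frechet_derivative_works by auto
  moreover have "((\<lambda>t. p + t *\<^sub>R axis j 1) has_derivative (\<lambda>t. t *\<^sub>R axis j 1)) (at (0::real))"
    by (auto intro!: derivative_eq_intros)
  ultimately have "((\<lambda>t. F (p + t *\<^sub>R axis j 1)) has_derivative
      (\<lambda>t. frechet_derivative F (at p) (t *\<^sub>R axis j 1))) (at 0)"
    using has_derivative_compose by fastforce
  then have "((\<lambda>t. F (p + t *\<^sub>R axis j 1) $ i) has_derivative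
      (\<lambda>t. frechet_derivative F (at p) (t *\<^sub>R axis j 1) $ i)) (at 0)"
    by (rule bounded_linear.has_derivative[OF bounded_linear_vec_nth])
  moreover have "frechet_derivative F (at p) (t *\<^sub>R axis j 1) $ i = jacobian F (at p) $ i $ j * t" for t
    using linear_frechet_derivative[OF assms]
    by (simp add: jacobian_def matrix_def linear_cmul)
  ultimately show ?thesis
    by (simp add: has_field_derivative_def)
qed

end

theory Submission
  imports Defs
begin

text \<open>
  The trace \<open>T\<close> is continuous, so its range is an interval that misses some \<open>c\<close>. Replacing \<open>F\<close>
  by \<open>- F\<close> if necessary, \<open>T < c\<close> everywhere. The characteristic polynomial
  \<open>1 - s T + s\<^sup>2\<close> of the derivative is then positive for all small \<open>s \<ge> 0\<close>. Hence
  \<open>G = F - t id\<close>, for small \<open>t > 0\<close>, has positive Jacobian determinant, and no real eigenvalue of its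
  derivative lies in \<open>(- t, t)\<close>: it has a spectral gap around zero. If \<open>F\<close> took the same value at two
  points, so would \<open>G\<close> for suitable small \<open>t\<close> (\<open>perturbation_not_injective\<close>). It therefore
  suffices that a locally injective map \<open>G\<close> with a spectral gap is injective (\<open>injective\<close>).

  Suppose \<open>G p = G q\<close>. Consider the points \<open>z\<close> for which the segment from \<open>G p\<close> to \<open>G z\<close> lifts through
  \<open>G\<close> to a path from \<open>p\<close> to \<open>z\<close>. They form an open set that contains \<open>p\<close> but not \<open>q\<close>, so it has a
  boundary point \<open>b\<close>: the segment from \<open>G p\<close> to \<open>G b\<close> does not lift to a path from \<open>p\<close> to \<open>b\<close>, although
  the corresponding segments for points \<open>z\<close> arbitrarily close to \<open>b\<close> do lift. In
  suitable affine coordinates the vertical edge \<open>{0} \<times> [0, 1]\<close> lifts, as do horizontal segments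
  issuing from its ends, but the segment from \<open>(0, 0)\<close> to \<open>(-1, 1)\<close> has no lift compatible with them.

  For every small slope \<open>m\<close>, sweep the lines \<open>x + m y = s\<close> from the edge to the left and extend the lift
  along with them. The sweep has to stop before it has covered the bad segment, and it can only stop
  because the lift \<open>\<Phi>\<close> becomes unbounded. On the other hand \<open>x + m y\<close> stays bounded along \<open>\<Phi>\<close> by a
  maximum principle (\<open>strip_bound\<close>): where \<open>\<plusminus> (x + m y) \<circ> \<Phi> + \<kappa> (x + m y)\<close> is maximal over the
  swept region, on its moving left side, the covector \<open>(1, m)\<close> is an eigenvector of the transposed
  derivative of \<open>\<Phi>\<close> with eigenvalue of modulus at least \<open>\<kappa>\<close>, and for large \<open>\<kappa>\<close> this contradicts the
  gap. So for each slope the image of \<open>\<Phi>\<close> has a spike that runs to infinity, upwards or downwards, inside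
  a strip around the line \<open>x + m y = 0\<close>.

  Among infinitely many slopes there are three whose spikes point in the same direction, say upwards.
  This is impossible for an orientation preserving injective \<open>\<Phi>\<close> (\<open>no_three_spikes\<close>). Take a highest
  point of the image of a region swept with the middle slope. There, moving up along the sweeping line
  moves the image to the right. But going up leads to the spike of the largest slope, which lies far to
  the left, and going down leads to the spike of the smallest slope, far to the right. So the images of
  the two ways have to cross (\<open>interlaced_spikes_meet\<close>, a consequence of the Fashoda theorem).
\<close>

section \<open>Lifts through locally injective maps\<close>

text \<open>A lift is a continuous right inverse of \<open>G\<close>, that is, a branch of the inverse over \<open>X\<close>.\<close>
definition lift_on :: "('a::euclidean_space \<Rightarrow> 'a) \<Rightarrow> 'a set \<Rightarrow> ('a \<Rightarrow> 'a) \<Rightarrow> bool" where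
  "lift_on G X \<phi> \<longleftrightarrow> continuous_on X \<phi> \<and> (\<forall>w\<in>X. G (\<phi> w) = w)"

lemma lift_on_subset: "lift_on G X \<phi> \<Longrightarrow> Y \<subseteq> X \<Longrightarrow> lift_on G Y \<phi>"
  unfolding lift_on_def using continuous_on_subset by blast

lemma open_line_nbhd:
  fixes w d :: "'a::real_normed_vector"
  assumes "open U" "w \<in> U"
  obtains e where "0 < e" "\<And>t. \<bar>t\<bar> < e \<Longrightarrow> w + t *\<^sub>R d \<in> U"
proof -
  have "open ((\<lambda>t. w + t *\<^sub>R d) -` U)"
    by (intro open_vimage assms continuous_intros)
  moreover have "0 \<in> (\<lambda>t. w + t *\<^sub>R d) -` U" using assms by simp
  ultimately obtain e where "0 < e" "ball 0 e \<subseteq> (\<lambda>t. w + t *\<^sub>R d) -` U"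
    using open_contains_ball by metis
  then show ?thesis by (intro that[of e]) (auto simp: subset_iff)
qed

locale locally_injective_map =
  fixes G :: "'a::euclidean_space \<Rightarrow> 'a"
  assumes cont: "continuous_on UNIV G"
    and locally_inj: "\<exists>e>0. inj_on G (ball p e)"
begin

lemma isCont_G: "isCont G x"
  using cont by (simp add: continuous_on_eq_continuous_at)

text \<open>The set of agreement is closed by continuity. It is open because near a point of agreement both
  lifts take values in a ball on which \<open>G\<close> is injective.\<close>
lemma lift_unique:
  assumes "connected X" "lift_on G X \<phi>" "lift_on G X \<psi>" "a \<in> X" "\<phi> a = \<psi> a" "w \<in> X"
  shows "\<phi> w = \<psi> w"
proof -
  define S where "S = {w \<in> X. \<phi> w - \<psi> w = 0}"
  have c: "continuous_on X \<phi>" "continuous_on X \<psi>" and G: "\<And>w. w \<in> X \<Longrightarrow> G (\<phi> w) = w \<and> G (\<psi> w) = w"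
    using assms unfolding lift_on_def by auto
  have "closedin (top_of_set X) S"
    unfolding S_def by (intro continuous_closedin_preimage_constant continuous_intros c)
  moreover have "openin (top_of_set X) S"
    unfolding openin_euclidean_subtopology_iff
  proof (intro conjI ballI)
    fix x assume "x \<in> S"
    then have x: "x \<in> X" "\<phi> x = \<psi> x" by (auto simp: S_def)
    obtain e where e: "e > 0" "inj_on G (ball (\<phi> x) e)" using locally_inj by blast
    obtain d1 where d1: "d1 > 0" "\<And>y. y \<in> X \<Longrightarrow> dist y x < d1 \<Longrightarrow> dist (\<phi> y) (\<phi> x) < e"
      using c(1) x(1) e(1) unfolding continuous_on_iff by metis
    obtain d2 where d2: "d2 > 0" "\<And>y. y \<in> X \<Longrightarrow> dist y x < d2 \<Longrightarrow> dist (\<psi> y) (\<psi> x) < e"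
      using c(2) x(1) e(1) unfolding continuous_on_iff by metis
    have "y \<in> S" if "y \<in> X" "dist y x < min d1 d2" for y
    proof -
      have "\<phi> y \<in> ball (\<phi> x) e" "\<psi> y \<in> ball (\<phi> x) e"
        using d1(2)[of y] d2(2)[of y] that x(2) by (auto simp: dist_commute)
      then have "\<phi> y = \<psi> y" using e(2) G[OF that(1)] by (metis inj_onD)
      then show ?thesis using that by (simp add: S_def)
    qed
    then show "\<exists>e>0. \<forall>x'\<in>X. dist x' x < e \<longrightarrow> x' \<in> S"
      using d1(1) d2(1) by (intro exI[of _ "min d1 d2"]) auto
  qed (auto simp: S_def)
  moreover have "a \<in> S" using assms by (simp add: S_def)
  ultimately have "S = X" using assms(1) unfolding connected_clopen by blast
  then show ?thesis using assms(6) by (auto simp: S_def)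
qed

text \<open>Otherwise pairs of distinct points with the same image come arbitrarily close to \<open>C\<close>. Limits of such
  pairs lie in \<open>C\<close> and have the same image, so they coincide, which contradicts injectivity near the
  common limit.\<close>
lemma inj_on_nbhd_of_compact:
  assumes "compact C" "inj_on G C"
  shows "\<exists>e>0. inj_on G (\<Union>c\<in>C. ball c e)"
proof (rule ccontr)
  assume "\<not> ?thesis"
  then have "\<forall>n. \<not> inj_on G (\<Union>c\<in>C. ball c (1 / real (Suc n)))" by simp
  then have not_inj: "\<not> inj_on G (\<Union>c\<in>C. ball c (1 / real (Suc n)))" for n by blast
  have "\<exists>c x d y. c \<in> C \<and> d \<in> C \<and> dist c x < 1 / real (Suc n) \<and> dist d y < 1 / real (Suc n)
      \<and> x \<noteq> y \<and> G x = G y" for n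
  proof -
    obtain x y where "x \<in> (\<Union>c\<in>C. ball c (1 / real (Suc n)))" "y \<in> (\<Union>c\<in>C. ball c (1 / real (Suc n)))"
      "x \<noteq> y" "G x = G y"
      using not_inj[of n] unfolding inj_on_def by blast
    then show ?thesis unfolding UN_iff mem_ball by blast
  qed
  then obtain c x d y where seq: "\<And>n. c n \<in> C" "\<And>n. d n \<in> C" "\<And>n. dist (c n) (x n) < 1 / real (Suc n)"
    "\<And>n. dist (d n) (y n) < 1 / real (Suc n)" "\<And>n::nat. x n \<noteq> y n" "\<And>n. G (x n) = G (y n)"
    by metis
  have "\<forall>n. (c n, d n) \<in> C \<times> C" using seq by simp
  then obtain l r where l: "l \<in> C \<times> C" "strict_mono r" "((\<lambda>n. (c n, d n)) \<circ> r) \<longlonglongrightarrow> l"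
    using seq_compactE[OF compact_imp_seq_compact[OF compact_Times[OF assms(1) assms(1)]], of "\<lambda>n. (c n, d n)"] by blast
  have cr: "(\<lambda>n. c (r n)) \<longlonglongrightarrow> fst l" "(\<lambda>n. d (r n)) \<longlonglongrightarrow> snd l"
    using tendsto_fst[OF l(3)] tendsto_snd[OF l(3)] by (simp_all add: o_def)
  have z: "(\<lambda>n. 1 / real (Suc (r n))) \<longlonglongrightarrow> 0"
    using LIMSEQ_subseq_LIMSEQ[OF LIMSEQ_inverse_real_of_nat l(2)]
    unfolding o_def inverse_eq_divide .
  have "(\<lambda>n. dist (c (r n)) (x (r n))) \<longlonglongrightarrow> 0"
    by (rule tendsto_sandwich[OF _ _ tendsto_const z]) (use seq(3) in \<open>auto intro!: always_eventually less_imp_le simp del: of_nat_Suc\<close>)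
  then have x: "(\<lambda>n. x (r n)) \<longlonglongrightarrow> fst l"
    using Lim_transform_eq[of "\<lambda>n. c (r n)" "\<lambda>n. x (r n)"] cr(1) by (simp add: dist_norm tendsto_norm_zero_iff)
  have "(\<lambda>n. dist (d (r n)) (y (r n))) \<longlonglongrightarrow> 0"
    by (rule tendsto_sandwich[OF _ _ tendsto_const z]) (use seq(4) in \<open>auto intro!: always_eventually less_imp_le simp del: of_nat_Suc\<close>)
  then have y: "(\<lambda>n. y (r n)) \<longlonglongrightarrow> snd l"
    using Lim_transform_eq[of "\<lambda>n. d (r n)" "\<lambda>n. y (r n)"] cr(2) by (simp add: dist_norm tendsto_norm_zero_iff)
  have "(\<lambda>n. G (x (r n))) \<longlonglongrightarrow> G (fst l)" "(\<lambda>n. G (y (r n))) \<longlonglongrightarrow> G (snd l)"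
    using isCont_tendsto_compose[OF isCont_G] x y by blast+
  then have "G (fst l) = G (snd l)" using seq(6) LIMSEQ_unique by simp
  then have eq: "fst l = snd l" using assms(2) l(1) by (metis inj_onD mem_Times_iff)
  obtain e where e: "e > 0" "inj_on G (ball (fst l) e)" using locally_inj by blast
  have "\<forall>\<^sub>F n in sequentially. dist (x (r n)) (fst l) < e \<and> dist (y (r n)) (fst l) < e"
    using x y e(1) unfolding eq by (intro eventually_conj tendstoD)
  then obtain n where "dist (x (r n)) (fst l) < e" "dist (y (r n)) (fst l) < e"
    by (auto simp: eventually_sequentially)
  then have "x (r n) = y (r n)"
    using e(2) seq(6) by (metis dist_commute inj_onD mem_ball)
  then show False using seq(5) by simp
qed

text \<open>\<open>G\<close> is injective on the compact image of the lift, hence on a neighbourhood of it. By invariance of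
  domain the inverse of \<open>G\<close> on that neighbourhood is a lift over an open set.\<close>
lemma lift_extend_nbhd:
  assumes "compact K" "lift_on G K \<phi>"
  obtains e \<psi> where "e > 0" "lift_on G (\<Union>k\<in>K. ball k e) \<psi>" "\<And>w. w \<in> K \<Longrightarrow> \<psi> w = \<phi> w"
proof -
  have \<phi>: "continuous_on K \<phi>" "\<And>w. w \<in> K \<Longrightarrow> G (\<phi> w) = w" using assms(2) by (auto simp: lift_on_def)
  have "compact (\<phi> ` K)" "inj_on G (\<phi> ` K)"
    using \<phi> assms(1) by (auto intro: compact_continuous_image inj_onI)
  from inj_on_nbhd_of_compact[OF this] obtain r where r: "r > 0" "inj_on G (\<Union>c\<in>\<phi> ` K. ball c r)" by blast
  define N where "N = (\<Union>c\<in>\<phi> ` K. ball c r)"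
  have N: "open N" "inj_on G N" "continuous_on N G" "\<phi> ` K \<subseteq> N"
    using r continuous_on_subset[OF cont] by (auto simp: N_def)
  obtain \<psi> where \<psi>: "homeomorphism N (G ` N) G \<psi>"
    using invariance_of_domain_homeomorphism[OF N(1,3) _ N(2)] by auto
  have "open (G ` N)" using invariance_of_domain N by blast
  moreover have "K \<subseteq> G ` N" using N(4) \<phi>(2) by (metis image_eqI image_subset_iff subsetI)
  ultimately obtain e where e: "e > 0" "(\<Union>k\<in>K. ball k e) \<subseteq> G ` N"
    using compact_subset_open_imp_ball_epsilon_subset[OF assms(1)] by metis
  show ?thesis
  proof
    show "e > 0" by fact
    show "lift_on G (\<Union>k\<in>K. ball k e) \<psi>"
      using e(2) \<psi> unfolding lift_on_def homeomorphism_def by (auto intro: continuous_on_subset)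
    show "\<psi> w = \<phi> w" if "w \<in> K" for w
      using \<psi> N(4) \<phi>(2)[OF that] that unfolding homeomorphism_def by (metis image_subset_iff)
  qed
qed

text \<open>A lift over a convex set can fail to extend to the closure only by being unbounded. If a bounded lift
  were not uniformly continuous, its values at arbitrarily close points would stay a fixed distance
  apart. Along the segment between such points it would then take values at any prescribed small
  distance from the first one. In the limit this yields two distinct preimages of a single point, as
  close to each other as desired, against local injectivity.\<close>
lemma lift_extend_closure:
  assumes "convex X" "lift_on G X \<phi>" "bounded (\<phi> ` X)"
  obtains \<psi> where "lift_on G (closure X) \<psi>" "\<And>w. w \<in> X \<Longrightarrow> \<psi> w = \<phi> w"
proof -
  have \<phi>: "continuous_on X \<phi>" "\<And>w. w \<in> X \<Longrightarrow> G (\<phi> w) = w" using assms(2) by (auto simp: lift_on_def)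
  define Q where "Q = closure (\<phi> ` X)"
  have "compact Q" using assms(3) by (simp add: Q_def)
  have "uniformly_continuous_on X \<phi>"
  proof (rule ccontr)
    assume "\<not> uniformly_continuous_on X \<phi>"
    then obtain \<epsilon> where \<epsilon>: "\<epsilon> > 0" "\<And>d. d > 0 \<Longrightarrow> \<exists>x\<in>X. \<exists>y\<in>X. dist y x < d \<and> \<epsilon> \<le> dist (\<phi> y) (\<phi> x)"
      unfolding uniformly_continuous_on_def by (meson not_le)
    have "\<exists>x y. x \<in> X \<and> y \<in> X \<and> dist y x < 1 / real (Suc n) \<and> \<epsilon> \<le> dist (\<phi> y) (\<phi> x)" for n
    proof -
      have "0 < 1 / real (Suc n)" by simp
      from \<epsilon>(2)[OF this] show ?thesis by blast
    qed
    then obtain x y where xy: "\<And>n. x n \<in> X" "\<And>n. y n \<in> X" "\<And>n::nat. dist (y n) (x n) < 1 / real (Suc n)"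
      "\<And>n. \<epsilon> \<le> dist (\<phi> (y n)) (\<phi> (x n))" by metis
    have "\<forall>n. \<phi> (x n) \<in> Q" using xy(1) closure_subset[of "\<phi> ` X"] by (auto simp: Q_def)
    then obtain p r where p: "strict_mono r" "(\<lambda>n. \<phi> (x (r n))) \<longlonglongrightarrow> p"
      using seq_compactE[OF compact_imp_seq_compact[OF \<open>compact Q\<close>], of "\<lambda>n. \<phi> (x n)"] unfolding o_def by blast
    obtain e0 where e0: "e0 > 0" "inj_on G (ball p e0)" using locally_inj by blast
    \<comment> \<open>The prescribed distance: small enough for injectivity of \<open>G\<close> near \<open>p\<close>, and below \<open>\<epsilon>\<close> so that it is attained along the segments.\<close>
    define e where "e = min (e0 / 2) (\<epsilon> / 2)"
    have e: "0 < e" "e < e0" "e < \<epsilon>" using e0 \<epsilon> by (auto simp: e_def)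
    have "\<forall>\<^sub>F n in sequentially. dist (\<phi> (x (r n))) p < e / 2"
      using p(2) e(1) by (intro tendstoD) auto
    then obtain n0 where n0: "\<And>n. n \<ge> n0 \<Longrightarrow> dist (\<phi> (x (r n))) p < e / 2"
      by (auto simp: eventually_sequentially)
    have "\<exists>z. z \<in> closed_segment (x (r n)) (y (r n)) \<and> dist (\<phi> (x (r n))) (\<phi> z) = e" for n
    proof -
      let ?S = "closed_segment (x (r n)) (y (r n))"
      have S: "?S \<subseteq> X" using xy assms(1) by (simp add: closed_segment_subset)
      have "connected ((\<lambda>z. dist (\<phi> (x (r n))) (\<phi> z)) ` ?S)"
        using continuous_on_subset[OF \<phi>(1) S] by (intro connected_continuous_image continuous_intros) auto
      moreover have "0 \<in> (\<lambda>z. dist (\<phi> (x (r n))) (\<phi> z)) ` ?S" by (intro image_eqI[of _ _ "x (r n)"]) auto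
      moreover have "dist (\<phi> (x (r n))) (\<phi> (y (r n))) \<in> (\<lambda>z. dist (\<phi> (x (r n))) (\<phi> z)) ` ?S"
        by (intro image_eqI[of _ _ "y (r n)"]) auto
      moreover have "e \<le> dist (\<phi> (x (r n))) (\<phi> (y (r n)))" using xy(4)[of "r n"] e by (simp add: dist_commute)
      ultimately have "e \<in> (\<lambda>z. dist (\<phi> (x (r n))) (\<phi> z)) ` ?S"
        using e(1) unfolding connected_iff_interval by (meson less_imp_le)
      then show ?thesis by auto
    qed
    then obtain z where z: "\<And>n. z n \<in> closed_segment (x (r n)) (y (r n))"
      "\<And>n. dist (\<phi> (x (r n))) (\<phi> (z n)) = e" by metis
    have zX: "z n \<in> X" for n using z xy assms(1) closed_segment_subset by blast
    have "\<forall>n. \<phi> (z n) \<in> Q" using zX closure_subset[of "\<phi> ` X"] by (auto simp: Q_def)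
    then obtain q r' where q: "strict_mono r'" "(\<lambda>n. \<phi> (z (r' n))) \<longlonglongrightarrow> q"
      using seq_compactE[OF compact_imp_seq_compact[OF \<open>compact Q\<close>], of "\<lambda>n. \<phi> (z n)"] unfolding o_def by blast
    have px: "(\<lambda>n. \<phi> (x (r (r' n)))) \<longlonglongrightarrow> p" using LIMSEQ_subseq_LIMSEQ[OF p(2) q(1)] by (simp add: o_def)
    have "(\<lambda>n. dist (\<phi> (x (r (r' n)))) (\<phi> (z (r' n)))) \<longlonglongrightarrow> dist p q"
      by (intro tendsto_dist px q)
    then have pq: "dist p q = e" by (simp add: z(2) LIMSEQ_const_iff)
    have "(\<lambda>n. G (\<phi> (x (r (r' n))))) \<longlonglongrightarrow> G p" "(\<lambda>n. G (\<phi> (z (r' n)))) \<longlonglongrightarrow> G q"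
      using isCont_tendsto_compose[OF isCont_G] px q(2) by blast+
    then have lims: "(\<lambda>n. x (r (r' n))) \<longlonglongrightarrow> G p" "(\<lambda>n. z (r' n)) \<longlonglongrightarrow> G q"
      using \<phi>(2) xy(1) zX by simp_all
    have zz: "(\<lambda>n. 1 / real (Suc (r (r' n)))) \<longlonglongrightarrow> 0"
      using LIMSEQ_subseq_LIMSEQ[OF LIMSEQ_inverse_real_of_nat strict_mono_o[OF p(1) q(1)]]
      unfolding o_def inverse_eq_divide .
    have "dist (x (r (r' n))) (z (r' n)) \<le> 1 / real (Suc (r (r' n)))" for n
    proof -
      have "dist (x (r (r' n))) (z (r' n)) \<le> dist (x (r (r' n))) (y (r (r' n)))"
        using segment_bound(1)[OF z(1)[of "r' n"]] by (simp add: dist_norm norm_minus_commute)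
      then show ?thesis using xy(3)[of "r (r' n)"] by (simp add: dist_commute)
    qed
    then have "(\<lambda>n. dist (x (r (r' n))) (z (r' n))) \<longlonglongrightarrow> 0"
      by (intro tendsto_sandwich[OF _ _ tendsto_const zz]) (auto intro!: always_eventually)
    moreover have "(\<lambda>n. dist (x (r (r' n))) (z (r' n))) \<longlonglongrightarrow> dist (G p) (G q)"
      by (intro tendsto_dist lims)
    ultimately have "G p = G q" using LIMSEQ_unique by fastforce
    moreover have "p \<in> ball p e0" "q \<in> ball p e0" using pq e e0 by auto
    ultimately have "p = q" using e0(2) by (meson inj_onD)
    then show False using pq e by simp
  qed
  then obtain \<psi> where \<psi>: "uniformly_continuous_on (closure X) \<psi>" "\<And>x. x \<in> X \<Longrightarrow> \<phi> x = \<psi> x"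
    using uniformly_continuous_on_extension_on_closure by metis
  show ?thesis
  proof
    have c: "continuous_on (closure X) \<psi>" using \<psi>(1) by (rule uniformly_continuous_imp_continuous)
    have "G (\<psi> w) - w = 0" if "w \<in> closure X" for w
    proof (rule continuous_constant_on_closure[of X "\<lambda>w. G (\<psi> w) - w" 0])
      show "continuous_on (closure X) (\<lambda>w. G (\<psi> w) - w)"
        using c by (intro continuous_intros continuous_on_compose2[OF cont c]) auto
    qed (use \<psi> \<phi> that in auto)
    then show "lift_on G (closure X) \<psi>" using c by (simp add: lift_on_def)
  qed (use \<psi> in auto)
qed

text \<open>Two lifts with the same value at \<open>a\<close>, over convex sets that contain \<open>a\<close>, agree on the intersection.
  So all of them are restrictions of one function.\<close>
lemma common_lift:
  obtains \<Phi> where "\<And>K \<phi> w. convex K \<Longrightarrow> a \<in> K \<Longrightarrow> lift_on G K \<phi> \<Longrightarrow> \<phi> a = p \<Longrightarrow> w \<in> K \<Longrightarrow> \<Phi> w = \<phi> w"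
proof -
  define \<Phi> where "\<Phi> w = (SOME q. \<exists>K \<phi>. convex K \<and> a \<in> K \<and> lift_on G K \<phi> \<and> \<phi> a = p \<and> w \<in> K \<and> q = \<phi> w)" for w
  have "\<Phi> w = \<phi> w" if K: "convex K" "a \<in> K" "lift_on G K \<phi>" "\<phi> a = p" "w \<in> K" for K \<phi> w
  proof -
    from K have "\<exists>q K \<phi>. convex K \<and> a \<in> K \<and> lift_on G K \<phi> \<and> \<phi> a = p \<and> w \<in> K \<and> q = \<phi> w" by blast
  from someI_ex[OF this] obtain K' \<phi>' where K': "convex K'" "a \<in> K'" "lift_on G K' \<phi>'" "\<phi>' a = p" "w \<in> K'" "\<Phi> w = \<phi>' w"
    unfolding \<Phi>_def by blast
  have "\<phi>' w = \<phi> w"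
  proof (rule lift_unique[where X = "K \<inter> K'" and \<phi> = \<phi>' and \<psi> = \<phi> and a = a])
    show "connected (K \<inter> K')" using K K' by (simp add: convex_Int convex_connected)
    show "lift_on G (K \<inter> K') \<phi>'" "lift_on G (K \<inter> K') \<phi>" using K(3) K'(3) lift_on_subset by blast+
  qed (use K K' in auto)
  then show "\<Phi> w = \<phi> w" using K' by simp
  qed
  then show thesis using that by blast
qed

lemma local_lift:
  obtains e \<psi> where "e > 0" "lift_on G (ball (G p) e) \<psi>" "\<psi> (G p) = p"
proof -
  have "lift_on G {G p} (\<lambda>_. p)" by (simp add: lift_on_def)
  from lift_extend_nbhd[OF _ this] that show ?thesis by auto
qed

text \<open>A branch of the inverse through \<open>z\<close> is a left inverse of \<open>G\<close> near \<open>z\<close>, by local injectivity at \<open>z\<close>.\<close>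
lemma lift_inverts_near:
  assumes "open N" "G z \<in> N" "lift_on G N \<psi>" "\<psi> (G z) = z"
  shows "\<forall>\<^sub>F x in nhds z. G x \<in> N \<and> \<psi> (G x) = x"
proof -
  obtain r where r: "r > 0" "inj_on G (ball z r)" using locally_inj by blast
  have lim: "(G \<longlongrightarrow> G z) (nhds z)" using isCont_G by (simp add: continuous_at tendsto_nhds_iff)
  then have N: "\<forall>\<^sub>F x in nhds z. G x \<in> N" using assms(1,2) by (rule topological_tendstoD)
  have "isCont \<psi> (G z)" using assms by (auto simp: lift_on_def continuous_on_eq_continuous_at)
  then have "((\<lambda>x. \<psi> (G x)) \<longlongrightarrow> z) (nhds z)"
    using isCont_tendsto_compose[OF _ lim] assms(4) by fastforce
  then have "\<forall>\<^sub>F x in nhds z. \<psi> (G x) \<in> ball z r"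
    using r(1) by (intro topological_tendstoD) auto
  moreover have "\<forall>\<^sub>F x in nhds z. x \<in> ball z r" using r(1) by (intro eventually_nhds_in_open) auto
  ultimately show ?thesis using N
  proof eventually_elim
    case (elim x)
    then have "G (\<psi> (G x)) = G x" using assms(3) by (simp add: lift_on_def)
    then show ?case using elim r(2) by (meson inj_onD)
  qed
qed

text \<open>The image of the branch of the inverse through \<open>p\<close>, continued along straight segments that start at
  \<open>G p\<close>.\<close>
definition segment_visible :: "'a \<Rightarrow> 'a set" where
  "segment_visible p = {z. \<exists>\<phi>. lift_on G (closed_segment (G p) (G z)) \<phi> \<and> \<phi> (G p) = p \<and> \<phi> (G z) = z}"

text \<open>A lift over a segment extends to a neighbourhood of the segment, which contains all segments with the
  same origin and a nearby end.\<close>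
lemma open_segment_visible: "open (segment_visible p)"
  unfolding open_subopen[of "segment_visible p"]
proof
  fix z assume "z \<in> segment_visible p"
  then obtain \<phi> where \<phi>: "lift_on G (closed_segment (G p) (G z)) \<phi>" "\<phi> (G p) = p" "\<phi> (G z) = z"
    by (auto simp: segment_visible_def)
  from lift_extend_nbhd[OF compact_segment \<phi>(1)] obtain e \<psi> where e: "e > 0"
    "lift_on G (\<Union>k\<in>closed_segment (G p) (G z). ball k e) \<psi>"
    "\<And>w. w \<in> closed_segment (G p) (G z) \<Longrightarrow> \<psi> w = \<phi> w" by blast
  define N where "N = (\<Union>k\<in>closed_segment (G p) (G z). ball k e)"
  have "open N" "G z \<in> N" using e(1) by (auto simp: N_def intro!: bexI[of _ "G z"])
  have "\<forall>\<^sub>F x in nhds z. G x \<in> N \<and> \<psi> (G x) = x"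
    by (rule lift_inverts_near) (use \<open>open N\<close> \<open>G z \<in> N\<close> e \<phi> in \<open>auto simp: N_def\<close>)
  moreover have "\<forall>\<^sub>F x in nhds z. G x \<in> ball (G z) e"
    using isCont_G e(1) by (intro topological_tendstoD[of G "G z"]) (auto simp: continuous_at tendsto_nhds_iff)
  ultimately have "\<forall>\<^sub>F x in nhds z. x \<in> segment_visible p"
  proof eventually_elim
    case (elim x)
    have "closed_segment (G p) (G x) \<subseteq> N"
    proof
      fix w assume "w \<in> closed_segment (G p) (G x)"
      then obtain u where u: "0 \<le> u" "u \<le> 1" "w = (1 - u) *\<^sub>R G p + u *\<^sub>R G x" by (auto simp: closed_segment_def)
      define k where "k = (1 - u) *\<^sub>R G p + u *\<^sub>R G z"
      have "k \<in> closed_segment (G p) (G z)" using u by (auto simp: k_def closed_segment_def)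
      moreover have "dist k w = u * dist (G z) (G x)"
        using u by (simp add: dist_norm k_def scaleR_diff_right[symmetric])
      then have "dist k w \<le> dist (G z) (G x)" using u by (simp add: mult_left_le_one_le)
      then have "w \<in> ball k e" using elim by simp
      ultimately show "w \<in> N" by (auto simp: N_def)
    qed
    then have "lift_on G (closed_segment (G p) (G x)) \<psi>" using e(2) lift_on_subset by (simp add: N_def)
    moreover have "\<psi> (G p) = p" using e(3) \<phi>(2) by simp
    ultimately show ?case using elim by (auto simp: segment_visible_def)
  qed
  then show "\<exists>T. open T \<and> z \<in> T \<and> T \<subseteq> segment_visible p"
    unfolding eventually_nhds by blast
qed

lemma segment_visible_self: "p \<in> segment_visible p"
  by (auto simp: segment_visible_def lift_on_def intro!: exI[of _ "\<lambda>_. p"])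

text \<open>If \<open>G b\<close> were \<open>G p\<close>, visible points near \<open>b\<close> would be values of the local branch of the inverse through
  \<open>p\<close> at points close to \<open>G p\<close>, so their limit \<open>b\<close> would be \<open>p\<close>, which is visible.\<close>
lemma frontier_point_image_ne:
  assumes b: "b \<in> closure (segment_visible p)" "b \<notin> segment_visible p"
  shows "G b \<noteq> G p"
proof
  assume eq: "G b = G p"
  obtain e \<psi> where e: "e > 0" "lift_on G (ball (G p) e) \<psi>" "\<psi> (G p) = p" using local_lift by blast
  obtain z where z: "\<And>n. z n \<in> segment_visible p" "z \<longlonglongrightarrow> b"
    using b(1) unfolding closure_sequential by blast
  have lim: "(\<lambda>n. G (z n)) \<longlonglongrightarrow> G p" using isCont_tendsto_compose[OF isCont_G z(2)] eq by simp
  have "isCont \<psi> (G p)" using e by (auto simp: lift_on_def continuous_on_eq_continuous_at)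
  from isCont_tendsto_compose[OF this lim] have "(\<lambda>n. \<psi> (G (z n))) \<longlonglongrightarrow> p" using e(3) by simp
  moreover have "\<forall>\<^sub>F n in sequentially. \<psi> (G (z n)) = z n"
  proof -
    have "\<forall>\<^sub>F n in sequentially. G (z n) \<in> ball (G p) e"
      using lim e(1) by (intro topological_tendstoD) auto
    then show ?thesis
    proof eventually_elim
      case (elim n)
      obtain \<phi> where \<phi>: "lift_on G (closed_segment (G p) (G (z n))) \<phi>" "\<phi> (G p) = p" "\<phi> (G (z n)) = z n"
        using z(1)[of n] by (auto simp: segment_visible_def)
      have "closed_segment (G p) (G (z n)) \<subseteq> ball (G p) e"
        using elim e(1) by (intro closed_segment_subset) auto
      from lift_on_subset[OF e(2) this] have "\<psi> (G (z n)) = \<phi> (G (z n))"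
        by (rule lift_unique[OF connected_segment _ \<phi>(1), of \<psi> "G p"]) (simp_all add: e(3) \<phi>(2))
      then show ?case using \<phi>(3) by simp
    qed
  qed
  ultimately have "z \<longlonglongrightarrow> p" using Lim_transform_eventually by blast
  then have "b = p" using z(2) LIMSEQ_unique by blast
  then show False using b(2) segment_visible_self by simp
qed

text \<open>Openness of \<open>G\<close>, in the form needed to move an image point off a given line.\<close>
lemma image_moves_in_direction:
  fixes V :: "'a set"
  assumes "open V" "z \<in> V"
  obtains z' t where "z' \<in> V" "t \<noteq> 0" "G z' = G z + t *\<^sub>R d"
proof -
  obtain r where r: "r > 0" "inj_on G (ball z r)" using locally_inj by blast
  have "open (G ` (V \<inter> ball z r))"
    using assms(1) r continuous_on_subset[OF cont]
    by (intro invariance_of_domain open_Int) (auto intro: inj_on_subset)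
  moreover have "G z \<in> G ` (V \<inter> ball z r)" using assms(2) r by auto
  ultimately obtain e where e: "0 < e" "\<And>t. \<bar>t\<bar> < e \<Longrightarrow> G z + t *\<^sub>R d \<in> G ` (V \<inter> ball z r)"
    using open_line_nbhd[of "G ` (V \<inter> ball z r)" "G z" d] by blast
  from e(2)[of "e / 2"] e(1) obtain z' where "z' \<in> V" "G z' = G z + (e / 2) *\<^sub>R d" by auto
  then show ?thesis using that[of z' "e / 2"] e(1) by simp
qed

end

section \<open>Derivatives along lines and matrices of size two\<close>

lemma matrix_vector_mult_2:
  fixes A :: "real ^ 2 ^ 2"
  shows "(A *v h) $ i = A $ i $ 1 * h $ 1 + A $ i $ 2 * h $ 2"
  by (simp add: matrix_vector_mult_def sum_2)

lemma has_derivative_along_line: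
  fixes h :: "'a::real_normed_vector \<Rightarrow> real"
  assumes "(h has_derivative h') (at w)"
  shows "((\<lambda>t. h (w + t *\<^sub>R d)) has_real_derivative h' d) (at 0)"
proof -
  interpret bounded_linear h' using assms by (rule has_derivative_bounded_linear)
  have "(h has_derivative h') (at (w + 0 *\<^sub>R d))" using assms by simp
  moreover have "((\<lambda>t. w + t *\<^sub>R d) has_derivative (\<lambda>t. t *\<^sub>R d)) (at (0::real))"
    by (auto intro!: derivative_eq_intros)
  ultimately have "((\<lambda>t. h (w + t *\<^sub>R d)) has_derivative (\<lambda>t. h' (t *\<^sub>R d))) (at 0)"
    using has_derivative_compose by fastforce
  moreover have "(\<lambda>t. h' (t *\<^sub>R d)) = (*) (h' d)"
    by (auto simp: scaleR)
  ultimately show ?thesis by (simp add: has_field_derivative_def)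
qed

lemma directional_derivative_nonpos:
  fixes h :: "'a::real_normed_vector \<Rightarrow> real"
  assumes "(h has_derivative h') (at w)" "0 < e"
    and "\<And>t. 0 < t \<Longrightarrow> t < e \<Longrightarrow> h (w + t *\<^sub>R d) \<le> h w"
  shows "h' d \<le> 0"
proof (rule ccontr)
  assume "\<not> h' d \<le> 0"
  from DERIV_pos_inc_right[OF has_derivative_along_line[OF assms(1)], of d] this obtain b where
    b: "0 < b" "\<forall>t>0. t < b \<longrightarrow> h (w + 0 *\<^sub>R d) < h (w + (0 + t) *\<^sub>R d)" by auto
  have "h w < h (w + (min b e / 2) *\<^sub>R d)"
    using b(2)[rule_format, of "min b e / 2"] b(1) assms(2) by auto
  moreover have "h (w + (min b e / 2) *\<^sub>R d) \<le> h w"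
    using assms(2) b(1) by (intro assms(3)) auto
  ultimately show False by simp
qed

lemma directional_derivative_pos:
  fixes h :: "'a::real_normed_vector \<Rightarrow> real"
  assumes "(h has_derivative h') (at w)" "0 < h' d"
  obtains e where "0 < e" "\<And>t. 0 < t \<Longrightarrow> t < e \<Longrightarrow> h w < h (w + t *\<^sub>R d)"
    "\<And>t. 0 < t \<Longrightarrow> t < e \<Longrightarrow> h (w - t *\<^sub>R d) < h w"
proof -
  note D = has_derivative_along_line[OF assms(1), of d]
  obtain a where a: "0 < a" "\<forall>t>0. t < a \<longrightarrow> h (w + 0 *\<^sub>R d) < h (w + (0 + t) *\<^sub>R d)"
    using DERIV_pos_inc_right[OF D assms(2)] by blast
  obtain b where b: "0 < b" "\<forall>t>0. t < b \<longrightarrow> h (w + (0 - t) *\<^sub>R d) < h (w + 0 *\<^sub>R d)"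
    using DERIV_pos_inc_left[OF D assms(2)] by blast
  show ?thesis
    using a b by (intro that[of "min a b"]) auto
qed

lemma mat_mult_vec: "mat s *v x = s *\<^sub>R (x :: real ^ 2)"
  by (simp add: vec_eq_iff matrix_vector_mult_2 mat_def forall_2)

section \<open>Strips in a half band\<close>

text \<open>The sweeping lines of slope \<open>m\<close> are the level lines of this functional. The same functional measures
  position in the target plane; using it on both sides is what turns extrema into eigenvectors.\<close>
definition slope_fn :: "real \<Rightarrow> real ^ 2 \<Rightarrow> real" where
  "slope_fn m w = w $ 1 + m * w $ 2"

text \<open>The part of the unit band to the left of the edge \<open>{0} \<times> [0, 1]\<close>.\<close>
definition half_band :: "(real ^ 2) set" where
  "half_band = {w. w $ 1 \<le> 0 \<and> 0 \<le> w $ 2 \<and> w $ 2 \<le> 1}"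

text \<open>The region swept by the lines of slope \<open>m\<close> when they move from the edge to the left, up to level \<open>s\<close>,
  without and with the final line.\<close>
definition open_strip :: "real \<Rightarrow> real \<Rightarrow> (real ^ 2) set" where
  "open_strip m s = {w \<in> half_band. s < slope_fn m w}"

definition closed_strip :: "real \<Rightarrow> real \<Rightarrow> (real ^ 2) set" where
  "closed_strip m s = {w \<in> half_band. s \<le> slope_fn m w}"

lemma slope_fn_linear: "linear (slope_fn m)"
  unfolding slope_fn_def by (intro linearI) (auto simp: algebra_simps)

lemma slope_fn_simps [simp]:
  "slope_fn m (x + y) = slope_fn m x + slope_fn m y"
  "slope_fn m (x - y) = slope_fn m x - slope_fn m y"
  "slope_fn m (- x) = - slope_fn m x"
  "slope_fn m (c *\<^sub>R x) = c * slope_fn m x"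
  by (auto simp: slope_fn_def algebra_simps)

lemma continuous_on_slope_fn [continuous_intros]:
  "continuous_on S f \<Longrightarrow> continuous_on S (\<lambda>x. slope_fn m (f x))"
  unfolding slope_fn_def by (intro continuous_intros)

lemma convex_half_band: "convex half_band"
proof -
  have "half_band = {w. inner (axis 1 1) w \<le> 0} \<inter> {w. inner (axis 2 1) w \<ge> 0} \<inter> {w. inner (axis 2 1) w \<le> 1}"
    by (auto simp: half_band_def inner_axis' )
  moreover have "convex \<dots>"
    by (intro convex_Int convex_halfspace_le convex_halfspace_ge)
  ultimately show ?thesis by metis
qed

lemma closed_half_band: "closed half_band"
  unfolding half_band_def by (intro closed_Collect_conj closed_Collect_le continuous_intros)

lemma interior_half_bandI: "w $ 1 < 0 \<Longrightarrow> 0 < w $ 2 \<Longrightarrow> w $ 2 < 1 \<Longrightarrow> w \<in> interior half_band"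
proof -
  have "open {w :: real ^ 2. w $ 1 < 0 \<and> 0 < w $ 2 \<and> w $ 2 < 1}"
    by (intro open_Collect_conj open_Collect_less continuous_intros)
  then show "w $ 1 < 0 \<Longrightarrow> 0 < w $ 2 \<Longrightarrow> w $ 2 < 1 \<Longrightarrow> w \<in> interior half_band"
    by (auto intro!: interiorI[where T = "{w. w $ 1 < 0 \<and> 0 < w $ 2 \<and> w $ 2 < 1}"] simp: half_band_def)
qed

lemma slope_fn_inner: "slope_fn m w = inner (axis 1 1 + m *\<^sub>R axis 2 1) w"
  by (simp add: slope_fn_def inner_add_left inner_axis')

lemma convex_open_strip: "convex (open_strip m s)"
proof -
  have "open_strip m s = half_band \<inter> {w. inner (axis 1 1 + m *\<^sub>R axis 2 1) w > s}"
    by (auto simp: open_strip_def slope_fn_inner)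
  then show ?thesis by (simp add: convex_Int convex_half_band convex_halfspace_gt)
qed

lemma convex_closed_strip: "convex (closed_strip m s)"
proof -
  have "closed_strip m s = half_band \<inter> {w. inner (axis 1 1 + m *\<^sub>R axis 2 1) w \<ge> s}"
    by (auto simp: closed_strip_def slope_fn_inner)
  then show ?thesis by (simp add: convex_Int convex_half_band convex_halfspace_ge)
qed

lemma slope_term_bound:
  fixes m v :: real
  assumes "\<bar>m\<bar> \<le> \<eta>" "0 \<le> v" "v \<le> 1" shows "\<bar>m * v\<bar> \<le> \<eta>"
  using assms mult_mono[of "\<bar>m\<bar>" \<eta> "\<bar>v\<bar>" 1] by (auto simp: abs_mult)

lemma compact_closed_strip: "compact (closed_strip m s)"
proof -
  have "norm w \<le> \<bar>s\<bar> + \<bar>m\<bar> + 1" if "w \<in> half_band" "s \<le> slope_fn m w" for w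
  proof -
    have "\<bar>m * w $ 2\<bar> \<le> \<bar>m\<bar>"
      using that by (intro slope_term_bound) (auto simp: half_band_def)
    then have "\<bar>w $ 1\<bar> + \<bar>w $ 2\<bar> \<le> \<bar>s\<bar> + \<bar>m\<bar> + 1"
      using that by (auto simp: half_band_def slope_fn_def)
    then show ?thesis using norm_le_l1_cart[of w] by (simp add: sum_2)
  qed
  then have "bounded (closed_strip m s)"
    by (auto simp: bounded_iff closed_strip_def)
  moreover have "closed (closed_strip m s)"
  proof -
    have "closed_strip m s = half_band \<inter> {w. s \<le> slope_fn m w}" by (auto simp: closed_strip_def)
    then show ?thesis
      by (simp add: closed_half_band closed_Int closed_Collect_le continuous_on_slope_fn)
  qed
  ultimately show ?thesis by (simp add: compact_eq_bounded_closed)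
qed

section \<open>Crossing paths in the plane\<close>

text \<open>Prolong both paths at both ends by vertical segments up to a horizontal line above everything. On this
  line the ends appear in the order: end of \<open>g\<close>, start of \<open>f\<close>, start of \<open>g\<close>, end of \<open>f\<close>. Paths with
  interlaced ends on one side of a box meet by the Fashoda theorem. The hypotheses on points above the
  level of \<open>P\<close> and on the vertical line above \<open>Q\<close> ensure that the intersection does not come from the
  added segments.\<close>
lemma interlaced_spikes_meet:
  fixes f g :: "real \<Rightarrow> real ^ 2"
  assumes f: "path f" "pathstart f = P" and g: "path g" "pathstart g = Q"
    and PQ: "P $ 1 < Q $ 1" "- M \<le> P $ 1" "Q $ 1 \<le> M" 
    and f_high: "P $ 2 < pathfinish f $ 2" "\<And>z. z \<in> path_image f \<Longrightarrow> P $ 2 < z $ 2 \<Longrightarrow> M < z $ 1"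
    and g_high: "P $ 2 < pathfinish g $ 2" "\<And>z. z \<in> path_image g \<Longrightarrow> P $ 2 < z $ 2 \<Longrightarrow> z $ 1 < - M"
    and gap: "\<And>z. z \<in> path_image f \<Longrightarrow> z $ 1 = Q $ 1 \<Longrightarrow> Q $ 2 \<le> z $ 2 \<Longrightarrow> P $ 2 < z $ 2"
  shows "path_image f \<inter> path_image g \<noteq> {}"
proof -
  have "bounded (path_image f \<union> path_image g)"
    using f g by (simp add: bounded_path_image)
  then obtain B0 where B0: "\<And>z. z \<in> path_image f \<union> path_image g \<Longrightarrow> norm z \<le> B0"
    by (auto simp: bounded_iff)
  define B where "B = B0 + 1"
  have box: "\<bar>z $ i\<bar> < B" if "z \<in> path_image f \<union> path_image g" for z i
    using B0[OF that] component_le_norm_cart[of z i] unfolding B_def by linarith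
  have ends: "pathstart f \<in> path_image f" "pathfinish f \<in> path_image f"
    "pathstart g \<in> path_image g" "pathfinish g \<in> path_image g"
    by auto
  define top :: "real ^ 2 \<Rightarrow> real ^ 2" where "top z = z + (B - z $ 2) *\<^sub>R axis 2 1" for z
  \<comment> \<open>The reflection that exchanges top and bottom, as the Fashoda theorem is about ends on the bottom side.\<close>
  define T :: "real ^ 2 \<Rightarrow> real ^ 2" where "T z = z - (2 * z $ 2) *\<^sub>R axis 2 1" for z
  have top [simp]: "top z $ 1 = z $ 1" "top z $ 2 = B" for z
    by (simp_all add: top_def axis_def)
  have T [simp]: "T z $ 1 = z $ 1" "T z $ 2 = - z $ 2" for z
    by (simp_all add: T_def axis_def)
  have contT: "continuous_on A T" for A
    unfolding T_def by (intro continuous_intros)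
  define f' where "f' = linepath (top P) P +++ f +++ linepath (pathfinish f) (top (pathfinish f))"
  define g' where "g' = linepath (top Q) Q +++ g +++ linepath (pathfinish g) (top (pathfinish g))"
  have f': "path f'" "pathstart f' = top P" "pathfinish f' = top (pathfinish f)"
    "path_image f' = closed_segment (top P) P \<union> path_image f \<union> closed_segment (pathfinish f) (top (pathfinish f))"
    using f unfolding f'_def by (auto simp: path_image_join)
  have g': "path g'" "pathstart g' = top Q" "pathfinish g' = top (pathfinish g)"
    "path_image g' = closed_segment (top Q) Q \<union> path_image g \<union> closed_segment (pathfinish g) (top (pathfinish g))"
    using g unfolding g'_def by (auto simp: path_image_join)
  have vert: "x \<in> closed_segment z (top z) \<Longrightarrow> x $ 1 = z $ 1 \<and> z $ 2 \<le> x $ 2 \<and> x $ 2 \<le> B" 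
    if "z \<in> path_image f \<union> path_image g" for x z
  proof -
    assume "x \<in> closed_segment z (top z)"
    then obtain u where u: "0 \<le> u" "u \<le> 1" "x = (1 - u) *\<^sub>R z + u *\<^sub>R top z"
      by (auto simp: closed_segment_def)
    have "z $ 2 \<le> B" using box[OF that, of 2] by simp
    moreover have "x $ 2 = z $ 2 + u * (B - z $ 2)" "x $ 1 = z $ 1"
      by (simp_all add: u(3) algebra_simps)
    moreover have "u * (B - z $ 2) \<le> B - z $ 2" "0 \<le> u * (B - z $ 2)"
      using \<open>z $ 2 \<le> B\<close> u(1,2) by (auto intro: mult_left_le_one_le)
    ultimately show ?thesis by auto
  qed
  have seg: "closed_segment (top z) z = closed_segment z (top z)" for z
    by (rule closed_segment_commute)
  let ?a = "vector [-B, -B] :: real ^ 2" and ?b = "vector [B, B] :: real ^ 2"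
  have inbox: "T x \<in> cbox ?a ?b" if "x \<in> path_image f' \<union> path_image g'" for x
  proof -
    have "\<bar>x $ 1\<bar> \<le> B \<and> \<bar>x $ 2\<bar> \<le> B"
      using that unfolding f'(4) g'(4) seg
    proof (elim UnE)
      assume "x \<in> closed_segment P (top P)"
      then show ?thesis using vert[of P x] box[of P 1] box[of P 2] ends f g by auto
    next
      assume "x \<in> closed_segment Q (top Q)"
      then show ?thesis using vert[of Q x] box[of Q 1] box[of Q 2] ends f g by auto
    next
      assume "x \<in> closed_segment (pathfinish f) (top (pathfinish f))"
      then show ?thesis
        using vert[of "pathfinish f" x] box[of "pathfinish f" 1] box[of "pathfinish f" 2] ends by auto
    next
      assume "x \<in> closed_segment (pathfinish g) (top (pathfinish g))"
      then show ?thesis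
        using vert[of "pathfinish g" x] box[of "pathfinish g" 1] box[of "pathfinish g" 2] ends by auto
    qed (use box in \<open>force simp: less_imp_le\<close>)+
    then show ?thesis
      by (auto simp: mem_box_cart forall_2)
  qed
  have left: "pathfinish g $ 1 < - M" and right: "M < pathfinish f $ 1"
    using f_high g_high ends by auto
  obtain z where z: "z \<in> path_image (T \<circ> reversepath g')" "z \<in> path_image (T \<circ> f')"
  proof (rule fashoda_interlace[of "T \<circ> reversepath g'" "T \<circ> f'" ?a ?b])
    show "path (T \<circ> reversepath g')" "path (T \<circ> f')"
      using f' g' contT by (auto intro!: path_continuous_image)
    show "path_image (T \<circ> reversepath g') \<subseteq> cbox ?a ?b" "path_image (T \<circ> f') \<subseteq> cbox ?a ?b"
      using inbox by (auto simp: path_image_compose)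
  qed (use f' g' left right PQ in \<open>auto simp: pathstart_compose pathfinish_compose\<close>)
  have injT: "x = y" if "T x = T y" for x y
    using arg_cong[OF that, of "\<lambda>v. v $ 1"] arg_cong[OF that, of "\<lambda>v. v $ 2"]
    by (simp add: vec_eq_iff forall_2)
  then obtain x where x: "x \<in> path_image f'" "x \<in> path_image g'"
    using z by (auto simp: path_image_compose)
  have mem: "P \<in> path_image f" "Q \<in> path_image g" using ends f g by auto
  have xf: "x \<in> path_image f \<or> (x $ 1 = P $ 1 \<and> P $ 2 < x $ 2) \<or> (M < x $ 1 \<and> P $ 2 < x $ 2)"
  proof -
    consider "x \<in> closed_segment P (top P)" | "x \<in> path_image f"
      | "x \<in> closed_segment (pathfinish f) (top (pathfinish f))"
      using x(1) unfolding f'(4) seg by blast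
    then show ?thesis
    proof cases
      case 1
      then have "x $ 1 = P $ 1" "P $ 2 \<le> x $ 2" using vert[of P x] mem by auto
      moreover have "x = P" if "x $ 2 = P $ 2"
        using that calculation by (simp add: vec_eq_iff forall_2)
      ultimately show ?thesis using mem by fastforce
    next
      case 3
      then show ?thesis using vert[of "pathfinish f" x] ends right f_high by auto
    qed auto
  qed
  have xg: "x \<in> path_image g \<or> (x $ 1 = Q $ 1 \<and> Q $ 2 \<le> x $ 2) \<or> (x $ 1 < - M \<and> P $ 2 < x $ 2)"
    using x(2) vert[of Q x] vert[of "pathfinish g" x] mem ends left g_high(1)
    unfolding g'(4) seg by auto
  show ?thesis
    using xf xg f_high(2)[of x] g_high(2)[of x] gap[of x] PQ by fastforce
qed

section \<open>Three spikes cannot coexist\<close>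

text \<open>Measure horizontal position by \<open>X = slope_fn m2\<close>. Above a certain height the spike of slope \<open>m1\<close> lies
  to the right of the middle strip \<open>\<bar>X\<bar> \<le> M\<close>, and the spike of slope \<open>m3\<close> to its left. Let \<open>w2\<close>
  be a highest point, with respect to the image, of a region swept with the middle slope. The height is
  critical along the sweeping line at \<open>w2\<close> and does not increase into the region, so a positive determinant
  forces \<open>X\<close> to increase along this line in the upward direction. A preimage \<open>w1\<close> of a far point of the
  first spike lies below \<open>w2\<close>: go down the sweeping line until the parallel of slope \<open>m1\<close> through
  \<open>w1\<close> is met, then follow that parallel to \<open>w1\<close>. Symmetrically, a preimage \<open>w3\<close> of a far point of the
  third spike is reached by starting from a point \<open>wr\<close> slightly above \<open>w2\<close> and going up. These ways are
  disjoint, one being below \<open>w2\<close> and the other above, but their images have to meet: the first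
  leaves the top to the left and ends on the right, the second does the opposite.\<close>
lemma no_three_spikes:
  fixes \<Phi> :: "real ^ 2 \<Rightarrow> real ^ 2" and m1 m2 m3 s1 s2 s3 :: real
  defines "K1 \<equiv> open_strip m1 s1" and "K2 \<equiv> open_strip m2 s2" and "K3 \<equiv> open_strip m3 s3"
  assumes slopes: "m1 < m2" "m2 < m3" "\<bar>m2\<bar> \<le> \<eta>"
    and cont: "continuous_on K1 \<Phi>" "continuous_on K2 \<Phi>" "continuous_on K3 \<Phi>"
    and inj: "inj_on \<Phi> (K1 \<union> K2 \<union> K3)"
    and deriv: "\<And>w. w \<in> K2 \<Longrightarrow> w \<in> interior half_band \<Longrightarrow>
        \<exists>A. (\<Phi> has_derivative (\<lambda>h. A *v h)) (at w) \<and> 0 < det A"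
    and strip: "\<And>w. w \<in> K1 \<Longrightarrow> \<bar>slope_fn m1 (\<Phi> w)\<bar> \<le> M"
      "\<And>w. w \<in> K2 \<Longrightarrow> \<bar>slope_fn m2 (\<Phi> w)\<bar> \<le> M"
      "\<And>w. w \<in> K3 \<Longrightarrow> \<bar>slope_fn m3 (\<Phi> w)\<bar> \<le> M"
    and frame: "\<And>w. w \<in> K2 \<Longrightarrow> w $ 2 = 0 \<or> w $ 2 = 1 \<or> - \<eta> \<le> slope_fn m2 w \<Longrightarrow> \<Phi> w $ 2 \<le> M"
    and spike: "\<And>R. \<exists>w\<in>K1. R < \<Phi> w $ 2" "\<And>R. \<exists>w\<in>K2. R < \<Phi> w $ 2" "\<And>R. \<exists>w\<in>K3. R < \<Phi> w $ 2"
  shows False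
proof -
  define X where "X w = slope_fn m2 (\<Phi> w)" for w
  define y where "y w = \<Phi> w $ 2" for w
  \<comment> \<open>The height above which the outer spikes have left the middle strip.\<close>
  define R0 where "R0 = max M (max ((2 * M + 1) / (m2 - m1)) ((2 * M + 1) / (m3 - m2)))"
  have R0: "M \<le> R0" "2 * M + 1 \<le> (m2 - m1) * R0" "2 * M + 1 \<le> (m3 - m2) * R0"
  proof -
    show "M \<le> R0" by (simp add: R0_def)
    have "(2 * M + 1) / (m2 - m1) \<le> R0" "(2 * M + 1) / (m3 - m2) \<le> R0"
      by (simp_all add: R0_def)
    then show "2 * M + 1 \<le> (m2 - m1) * R0" "2 * M + 1 \<le> (m3 - m2) * R0"
      using slopes by (simp_all add: divide_le_eq mult.commute)
  qed
  obtain wt where wt: "wt \<in> K2" "R0 < y wt" using spike(2)[of R0] by (auto simp: y_def)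
  define C where "C = closed_strip m2 (slope_fn m2 wt)"
  have CK: "C \<subseteq> K2" using wt by (auto simp: C_def closed_strip_def K2_def open_strip_def)
  have "continuous_on C y"
    unfolding y_def using continuous_on_subset[OF cont(2) CK] by (auto intro!: continuous_intros)
  moreover have "compact C" by (simp add: C_def compact_closed_strip)
  moreover have "wt \<in> C" using wt by (auto simp: C_def closed_strip_def K2_def open_strip_def)
  ultimately obtain w2 where w2: "w2 \<in> C" "\<And>w. w \<in> C \<Longrightarrow> y w \<le> y w2"
    by (metis continuous_attains_sup empty_iff)
  define Y where "Y = y w2"
  define c where "c = slope_fn m2 w2"
  have Y: "R0 < Y" using w2(2)[OF \<open>wt \<in> C\<close>] wt(2) by (simp add: Y_def)
  have w2K: "w2 \<in> K2" using w2 CK by auto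
  have band: "w $ 1 \<le> 0" "0 \<le> w $ 2" "w $ 2 \<le> 1" if "w \<in> half_band" for w
    using that by (auto simp: half_band_def)
  have c: "c < - \<eta>" and v2: "0 < w2 $ 2" "w2 $ 2 < 1"
    using frame[OF w2K] Y R0(1) band[of w2] w2K by (force simp: c_def Y_def y_def K2_def open_strip_def)+
  have cC: "w \<in> C" if "slope_fn m2 w = c" "0 \<le> w $ 2" "w $ 2 \<le> 1" for w
  proof -
    have "\<bar>m2 * w $ 2\<bar> \<le> \<eta>" using slope_term_bound slopes that by blast
    then show ?thesis using that c w2(1) by (auto simp: C_def closed_strip_def half_band_def c_def slope_fn_def)
  qed
  have "w2 $ 1 < 0"
  proof -
    have "\<bar>m2 * w2 $ 2\<bar> \<le> \<eta>" using slope_term_bound slopes v2 by simp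
    then show ?thesis using c by (auto simp: c_def slope_fn_def)
  qed
  then have int: "w2 \<in> interior half_band" using v2 interior_half_bandI by blast
  from deriv[OF w2K int] obtain A where A: "(\<Phi> has_derivative (\<lambda>h. A *v h)) (at w2)" "0 < det A"
    by blast
  \<comment> \<open>Upward direction of the sweeping line, and the direction into the swept region.\<close>
  define \<tau> :: "real ^ 2" where "\<tau> = axis 2 1 - m2 *\<^sub>R axis 1 1"
  define n :: "real ^ 2" where "n = axis 1 1"
  have \<tau>: "\<tau> $ 1 = - m2" "\<tau> $ 2 = 1" and n: "n $ 1 = 1" "n $ 2 = 0"
    by (simp_all add: \<tau>_def n_def axis_def)
  have L\<tau>: "slope_fn m2 \<tau> = 0" and Ln: "slope_fn m2 n = 1"
    by (simp_all add: slope_fn_def \<tau> n)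
  have dy: "(y has_derivative (\<lambda>h. (A *v h) $ 2)) (at w2)"
    unfolding y_def by (rule bounded_linear.has_derivative[OF bounded_linear_vec_nth A(1)])
  have dX: "(X has_derivative (\<lambda>h. slope_fn m2 (A *v h))) (at w2)"
    unfolding X_def using slope_fn_linear linear_conv_bounded_linear
    by (intro bounded_linear.has_derivative[OF _ A(1)]) blast
  have nonpos: "(A *v d) $ 2 \<le> 0" if "0 \<le> slope_fn m2 d" for d
  proof -
    obtain e where e: "0 < e" "\<And>t. \<bar>t\<bar> < e \<Longrightarrow> w2 + t *\<^sub>R d \<in> interior half_band"
      using open_line_nbhd[OF open_interior int, of d] by blast
    have "y (w2 + t *\<^sub>R d) \<le> y w2" if "0 < t" "t < e" for t
      using e(2)[of t] that interior_subset[of half_band] w2(1) \<open>0 \<le> slope_fn m2 d\<close>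
      by (intro w2(2)) (auto simp: C_def closed_strip_def intro: order_trans)
    then show ?thesis using directional_derivative_nonpos[OF dy e(1)] by simp
  qed
  have "(A *v \<tau>) $ 2 \<le> 0" "(A *v (- \<tau>)) $ 2 \<le> 0" "(A *v n) $ 2 \<le> 0"
    by (intro nonpos; simp add: L\<tau> Ln)+
  then have A2: "A $ 2 $ 2 = m2 * A $ 2 $ 1" "A $ 2 $ 1 \<le> 0"
    by (auto simp: matrix_vector_mult_2 \<tau> n mult.commute)
  have "0 < - A $ 2 $ 1 * (A $ 1 $ 2 - m2 * A $ 1 $ 1)"
    using A(2) unfolding det_2 A2(1) by (simp add: algebra_simps)
  then have "0 < A $ 1 $ 2 - m2 * A $ 1 $ 1"
    using A2(2) by (simp add: zero_less_mult_iff mult_less_0_iff)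
  then have "0 < slope_fn m2 (A *v \<tau>)"
    by (simp add: slope_fn_def matrix_vector_mult_2 \<tau> A2(1) algebra_simps)
  from directional_derivative_pos[OF dX this] obtain d where d: "0 < d"
    "\<And>t. 0 < t \<Longrightarrow> t < d \<Longrightarrow> X w2 < X (w2 + t *\<^sub>R \<tau>)"
    "\<And>t. 0 < t \<Longrightarrow> t < d \<Longrightarrow> X (w2 - t *\<^sub>R \<tau>) < X w2" by blast
  have X_bd: "\<bar>X w\<bar> \<le> M" if "w \<in> K2" for w using strip(2)[of w] that by (simp add: X_def)
  have X1: "M < X w" if "w \<in> K1" "Y \<le> y w" for w
  proof -
    have "X w = slope_fn m1 (\<Phi> w) + (m2 - m1) * y w"
      by (simp add: X_def slope_fn_def y_def algebra_simps)
    moreover have "(m2 - m1) * R0 \<le> (m2 - m1) * y w"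
      using that(2) Y slopes by (intro mult_left_mono) auto
    ultimately show ?thesis using strip(1)[of w] that(1) R0(2) by simp
  qed
  have X3: "X w < - M" if "w \<in> K3" "Y \<le> y w" for w
  proof -
    have "X w = slope_fn m3 (\<Phi> w) - (m3 - m2) * y w"
      by (simp add: X_def slope_fn_def y_def algebra_simps)
    moreover have "(m3 - m2) * R0 \<le> (m3 - m2) * y w"
      using that(2) Y slopes by (intro mult_left_mono) auto
    ultimately show ?thesis using strip(3)[of w] that(1) R0(3) by simp
  qed
  obtain w1 where w1: "w1 \<in> K1" "Y < y w1" using spike(1)[of Y] by (auto simp: y_def)
  obtain w3 where w3: "w3 \<in> K3" "Y < y w3" using spike(3)[of Y] by (auto simp: y_def)
  have out: "w1 \<notin> K2" "w3 \<notin> K2" "w2 \<notin> K1" "w2 \<notin> K3"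
    using X1[OF w1(1)] X3[OF w3(1)] X1[of w2] X3[of w2] X_bd[of w1] X_bd[of w2] X_bd[of w3] w1(2) w3(2) w2K
    by (auto simp: Y_def)
  have L1: "slope_fn m1 w = slope_fn m2 w - (m2 - m1) * w $ 2"
    and L3: "slope_fn m3 w = slope_fn m2 w + (m3 - m2) * w $ 2" for w
    by (simp_all add: slope_fn_def algebra_simps)
  have mem: "w \<in> K1 \<longleftrightarrow> w \<in> half_band \<and> s1 < slope_fn m1 w" "w \<in> K2 \<longleftrightarrow> w \<in> half_band \<and> s2 < slope_fn m2 w"
    "w \<in> K3 \<longleftrightarrow> w \<in> half_band \<and> s3 < slope_fn m3 w" for w
    by (auto simp: K1_def K2_def K3_def open_strip_def)
  \<comment> \<open>The point at height \<open>v\<close> on the sweeping line through \<open>w2\<close>.\<close>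
  define pt where "pt v = w2 + (v - w2 $ 2) *\<^sub>R \<tau>" for v
  have pt: "slope_fn m2 (pt v) = c" "pt v $ 2 = v" for v
    using L\<tau> by (simp_all add: pt_def c_def \<tau>)
  have c2: "s2 < c" using w2K by (simp add: mem c_def)
  \<comment> \<open>Heights at which the sweeping line meets the parallels of slopes \<open>m1\<close> through \<open>w1\<close> and \<open>m3\<close> through \<open>w3\<close>.\<close>
  define a where "a = (c - slope_fn m1 w1) / (m2 - m1)"
  define b where "b = (slope_fn m3 w3 - c) / (m3 - m2)"
  have ab: "(m2 - m1) * a = c - slope_fn m1 w1" "(m3 - m2) * b = slope_fn m3 w3 - c"
    using slopes by (simp_all add: a_def b_def)
  have "slope_fn m1 w2 \<le> s1" "slope_fn m3 w2 \<le> s3" "slope_fn m2 w1 \<le> s2" "slope_fn m2 w3 \<le> s2"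
    using out w1 w3 w2K by (auto simp: mem)
  then have "(m2 - m1) * a < (m2 - m1) * w2 $ 2" "(m2 - m1) * w1 $ 2 < (m2 - m1) * a"
    "(m3 - m2) * w2 $ 2 < (m3 - m2) * b" "(m3 - m2) * b < (m3 - m2) * w3 $ 2"
    using w1(1) w3(1) c2 L1[of w2] L1[of w1] L3[of w2] L3[of w3] unfolding ab mem c_def by linarith+
  then have a: "w1 $ 2 < a" "a < w2 $ 2" and b: "w2 $ 2 < b" "b < w3 $ 2"
    using slopes by (simp_all add: mult_less_cancel_left_pos)
  have hts: "0 \<le> w1 $ 2" "w3 $ 2 \<le> 1" using w1 w3 band by (auto simp: mem)
  have ptC: "pt v \<in> C" if "w1 $ 2 \<le> v" "v \<le> w3 $ 2" for v
    using cC[of "pt v"] that hts by (simp add: pt)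
  have ptK: "pt a \<in> K1" "pt b \<in> K3"
    using ptC[of a] ptC[of b] a b w1(1) w3(1) ab by (auto simp: mem L1 L3 pt C_def closed_strip_def)
  have pt_w2: "pt (w2 $ 2) = w2" by (simp add: pt_def)
  have convs: "convex K1" "convex K3" "convex C"
    by (simp_all add: K1_def K3_def C_def convex_open_strip convex_closed_strip)
  have segC: "closed_segment (pt v) (pt v') \<subseteq> C"
    if "w1 $ 2 \<le> v" "v \<le> w3 $ 2" "w1 $ 2 \<le> v'" "v' \<le> w3 $ 2" for v v'
    using that ptC convs by (intro closed_segment_subset) auto
  have seg1: "closed_segment (pt a) w1 \<subseteq> K1" and seg3: "closed_segment (pt b) w3 \<subseteq> K3"
    using closed_segment_subset[OF ptK(1) w1(1) convs(1)] closed_segment_subset[OF ptK(2) w3(1) convs(2)] .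
  have seg_height: "w $ 2 \<in> closed_segment (p $ 2) (q $ 2)" if "w \<in> closed_segment p q" for w p q :: "real ^ 2"
    using that by (force simp: closed_segment_def)
  \<comment> \<open>The image in sheared coordinates, in which the middle strip is vertical.\<close>
  define E where "E w = \<Phi> w + (m2 * \<Phi> w $ 2) *\<^sub>R axis 1 1" for w
  have E [simp]: "E w $ 1 = X w" "E w $ 2 = y w" for w
    by (simp_all add: E_def X_def y_def slope_fn_def axis_def)
  have injE: "p = q" if "E p = E q" "p \<in> K1 \<union> K2 \<union> K3" "q \<in> K1 \<union> K2 \<union> K3" for p q
  proof -
    have "X p = X q" "y p = y q" using that(1) E by metis+
    then have "\<Phi> p = \<Phi> q" by (simp add: X_def y_def slope_fn_def vec_eq_iff forall_2)
    then show ?thesis using inj that by (simp add: inj_on_def)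
  qed
  have contE: "continuous_on S E" if "S \<subseteq> K1 \<or> S \<subseteq> K2 \<or> S \<subseteq> K3" for S
    using that cont continuous_on_subset unfolding E_def by (auto intro!: continuous_intros)
  define near where "near = closed_segment w2 (pt a)"
  define far where "far = closed_segment (pt a) w1"
  have near: "w \<in> C" "a \<le> w $ 2" "w $ 2 \<le> w2 $ 2" "w = pt (w $ 2)" if wn: "w \<in> near" for w
  proof -
    show "w \<in> C" using segC[of "w2 $ 2" a] a b that by (auto simp: near_def pt_w2)
    show "a \<le> w $ 2" "w $ 2 \<le> w2 $ 2"
      using seg_height[of w w2 "pt a"] that a by (auto simp: near_def pt closed_segment_eq_real_ivl)
    obtain u where u: "w = (1 - u) *\<^sub>R w2 + u *\<^sub>R pt a" using wn by (auto simp: near_def closed_segment_def)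
    then have w: "w = w2 + (u * (a - w2 $ 2)) *\<^sub>R \<tau>" by (simp add: pt_def algebra_simps)
    then have "w $ 2 = w2 $ 2 + u * (a - w2 $ 2)" by (simp add: \<tau>)
    then show "w = pt (w $ 2)" using w by (simp add: pt_def)
  qed
  have far: "w \<in> K1" "w $ 2 \<le> a" if "w \<in> far" for w
    using seg1 that seg_height[of w "pt a" w1] a by (auto simp: far_def pt closed_segment_eq_real_ivl)
  \<comment> \<open>The part of the first way away from \<open>w2\<close>. Its image keeps a positive distance from the top \<open>E w2\<close>, so for \<open>wr\<close> close to \<open>w2\<close> it avoids the short vertical segment above \<open>E wr\<close> up to the height of the top. The image of the remaining part of the way is not to the right of the top.\<close>
  define rest where "rest = E ` (near \<inter> {w. w $ 2 \<le> w2 $ 2 - d} \<union> far)"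
  have "compact rest"
  proof -
    have "compact (near \<inter> {w. w $ 2 \<le> w2 $ 2 - d})"
      unfolding near_def by (intro compact_Int_closed closed_Collect_le continuous_intros) auto
    moreover have "near \<subseteq> K2" "far \<subseteq> K1" using near(1) far(1) CK by auto
    ultimately have "compact (E ` (near \<inter> {w. w $ 2 \<le> w2 $ 2 - d}))" "compact (E ` far)"
      by (auto intro!: compact_continuous_image contE simp: far_def)
    then show ?thesis by (simp add: rest_def image_Un compact_Un)
  qed
  moreover have "E w2 \<notin> rest"
  proof
    assume "E w2 \<in> rest"
    then obtain w where w: "w \<in> near \<inter> {w. w $ 2 \<le> w2 $ 2 - d} \<union> far" "E w2 = E w"
      by (auto simp: rest_def)
    then have "w2 = w" using near(1) far(1) CK w2K by - (rule injE, auto)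
    then show False using w(1) d(1) far[of w] a by auto
  qed
  ultimately obtain \<rho> where \<rho>: "0 < \<rho>" "\<And>z. z \<in> rest \<Longrightarrow> \<rho> \<le> dist (E w2) z"
    using separate_point_closed[OF compact_imp_closed, of rest "E w2"] by auto
  have "isCont (\<lambda>t. E (w2 + t *\<^sub>R \<tau>)) 0"
  proof -
    have "isCont E (w2 + 0 *\<^sub>R \<tau>)"
      unfolding E_def using has_derivative_continuous[OF A(1)] by (auto intro!: continuous_intros)
    then show ?thesis
      by (intro isCont_o2[where g = E and f = "\<lambda>t. w2 + t *\<^sub>R \<tau>"]) (auto intro!: continuous_intros)
  qed
  then obtain e where e: "0 < e" "\<And>t. dist t 0 < e \<Longrightarrow> dist (E (w2 + t *\<^sub>R \<tau>)) (E w2) < \<rho> / 2"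
    unfolding continuous_at_eps_delta using \<rho>(1) by (force dest: spec[of _ "\<rho> / 2"])
  define t where "t = min (min d e) (b - w2 $ 2) / 2"
  have t: "0 < t" "t < d" "t < e" "t < b - w2 $ 2" using d(1) e(1) b by (auto simp: t_def)
  define wr where "wr = pt (w2 $ 2 + t)"
  have wr: "wr = w2 + t *\<^sub>R \<tau>" "wr $ 2 = w2 $ 2 + t" by (simp_all add: wr_def pt_def \<tau>)
  have wrC: "wr \<in> C" using ptC[of "w2 $ 2 + t"] a b t by (simp add: wr_def)
  define f where "f = E \<circ> (linepath w2 (pt a) +++ linepath (pt a) w1)"
  define g where "g = E \<circ> (linepath wr (pt b) +++ linepath (pt b) w3)"
  have imf: "path_image f = E ` (near \<union> far)"
    by (simp add: f_def path_image_compose path_image_join near_def far_def)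
  define near' where "near' = closed_segment wr (pt b)"
  define far' where "far' = closed_segment (pt b) w3"
  have img: "path_image g = E ` (near' \<union> far')"
    by (simp add: g_def path_image_compose path_image_join near'_def far'_def)
  have near': "w \<in> C" "w2 $ 2 < w $ 2" if "w \<in> near'" for w
    using segC[of "w2 $ 2 + t" b] a b t that seg_height[of w wr "pt b"]
    by (auto simp: near'_def wr_def pt closed_segment_eq_real_ivl)
  have far': "w \<in> K3" "w2 $ 2 < w $ 2" if "w \<in> far'" for w
    using seg3 that seg_height[of w "pt b" w3] b by (auto simp: far'_def pt closed_segment_eq_real_ivl)
  have "path_image f \<inter> path_image g \<noteq> {}"
  proof (rule interlaced_spikes_meet[where P = "E w2" and Q = "E wr" and M = M])
    show "path f" "path g"
    proof -
      have "near \<subseteq> K2" "far \<subseteq> K1" "near' \<subseteq> K2" "far' \<subseteq> K3" using near(1) far(1) near'(1) far'(1) CK by auto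
      then have "continuous_on near E" "continuous_on far E" "continuous_on near' E" "continuous_on far' E"
        by (auto intro: contE)
      then have "path (E \<circ> linepath w2 (pt a))" "path (E \<circ> linepath (pt a) w1)"
        "path (E \<circ> linepath wr (pt b))" "path (E \<circ> linepath (pt b) w3)"
        by (auto intro!: path_continuous_image simp: near_def far_def near'_def far'_def)
      then show "path f" "path g"
        unfolding f_def g_def path_compose_join by (auto intro!: path_join_imp simp: pathfinish_compose pathstart_compose)
    qed
    show "pathstart f = E w2" "pathstart g = E wr"
      by (simp_all add: f_def g_def pathstart_compose)
    show "E w2 $ 1 < E wr $ 1" using d(2)[of t] t by (simp add: wr)
    show "- M \<le> E w2 $ 1" "E wr $ 1 \<le> M" using X_bd[of w2] X_bd[of wr] w2K wrC CK by auto
    show "E w2 $ 2 < pathfinish f $ 2" "E w2 $ 2 < pathfinish g $ 2"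
      using w1 w3 by (simp_all add: f_def g_def pathfinish_compose Y_def)
    show "M < z $ 1" if "z \<in> path_image f" "E w2 $ 2 < z $ 2" for z
      using that near(1) w2(2) far(1) X1 unfolding imf by (fastforce simp: Y_def)
    show "z $ 1 < - M" if "z \<in> path_image g" "E w2 $ 2 < z $ 2" for z
      using that near'(1) w2(2) far'(1) X3 unfolding img by (fastforce simp: Y_def)
    show "E w2 $ 2 < z $ 2" if z: "z \<in> path_image f" "z $ 1 = E wr $ 1" "E wr $ 2 \<le> z $ 2" for z
    proof (rule ccontr)
      assume le: "\<not> E w2 $ 2 < z $ 2"
      have "dist (E wr) (E w2) < \<rho> / 2" using e(2)[of t] t by (simp add: wr)
      then have "\<bar>E wr $ i - E w2 $ i\<bar> < \<rho> / 2" for i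
        by (metis component_le_norm_cart dist_norm le_less_trans vector_minus_component)
      from this[of 1] this[of 2] have "\<bar>z $ 1 - E w2 $ 1\<bar> < \<rho> / 2" "\<bar>z $ 2 - E w2 $ 2\<bar> < \<rho> / 2"
        using z le by auto
      then have "dist (E w2) z < \<rho>"
        using norm_le_l1_cart[of "z - E w2"] by (simp add: sum_2 dist_norm norm_minus_commute)
      then have "z \<notin> rest" using \<rho>(2) by force
      moreover obtain w where "w \<in> near \<union> far" "z = E w" using z(1) unfolding imf by blast
      ultimately have "w \<notin> near \<inter> {w. w $ 2 \<le> w2 $ 2 - d} \<union> far" unfolding rest_def by blast
      with \<open>w \<in> near \<union> far\<close> have w: "w \<in> near" "w2 $ 2 - d < w $ 2" by auto
      define r where "r = w2 $ 2 - w $ 2"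
      have "w = w2 - r *\<^sub>R \<tau>" using near(4)[OF w(1)] by (simp add: pt_def r_def algebra_simps)
      moreover have "0 \<le> r" "r < d" using near(3)[OF w(1)] w(2) by (auto simp: r_def)
      ultimately have "X w \<le> X w2" using d(3)[of r] by (cases "r = 0") auto
      moreover have "X w2 < X wr" using d(2)[of t] t by (simp add: wr)
      ultimately show False using z(2) \<open>z = E w\<close> by simp
    qed
  qed
  then obtain p q where pq: "p \<in> near \<union> far" "q \<in> near' \<union> far'" "E p = E q"
    unfolding imf img by auto
  then have "p = q" using near(1) far(1) near'(1) far'(1) CK by - (rule injE, auto)
  moreover have "p $ 2 \<le> w2 $ 2" "w2 $ 2 < q $ 2"
    using pq near(3) far(2) a near'(2) far'(2) by force+
  ultimately show False by simp
qed

section \<open>Maps with a spectral gap around zero\<close>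

lemma infinite_imp_ordered_triple:
  fixes S :: "'a::linorder set"
  assumes "infinite S"
  obtains a b c where "a \<in> S" "b \<in> S" "c \<in> S" "a < b" "b < c"
proof -
  obtain T where "T \<subseteq> S" "card T = 3" using infinite_arbitrarily_large[OF assms] by blast
  then obtain x y z where "x \<in> S" "y \<in> S" "z \<in> S" "x \<noteq> y" "y \<noteq> z" "x \<noteq> z"
    unfolding card_3_iff by auto
  then show ?thesis
    by (cases x y rule: linorder_cases; cases y z rule: linorder_cases; cases x z rule: linorder_cases)
      (use that in blast)+
qed

text \<open>What remains of the trace bound: the derivative preserves orientation and has no real eigenvalue in
  \<open>(- \<delta>, \<delta>)\<close>.\<close>
locale spectral_gap_map = locally_injective_map G for G :: "real ^ 2 \<Rightarrow> real ^ 2" +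
  fixes A :: "real ^ 2 \<Rightarrow> real ^ 2 ^ 2" and \<delta> :: real
  assumes deriv: "(G has_derivative (*v) (A p)) (at p)"
    and det_pos: "0 < det (A p)"
    and \<delta>_pos: "0 < \<delta>"
    and gap: "\<bar>s\<bar> < \<delta> \<Longrightarrow> det (A p - mat s) \<noteq> 0"
begin

lemma lift_has_derivative:
  assumes "open N" "w \<in> N" "lift_on G N \<phi>"
  obtains B where "(\<phi> has_derivative (*v) B) (at w)" "B ** A (\<phi> w) = mat 1" "0 < det B"
proof -
  let ?A = "A (\<phi> w)"
  have "invertible ?A" using det_pos[of "\<phi> w"] by (simp add: invertible_det_nz)
  then obtain B where B: "B ** ?A = mat 1" unfolding invertible_left_inverse by blast
  have "det B * det ?A = 1" using arg_cong[OF B, of det] by (simp add: det_mul)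
  then have "0 < det B" using det_pos[of "\<phi> w"] zero_less_mult_pos2[of "det B" "det ?A"] by simp
  moreover have "(\<phi> has_derivative (*v) B) (at w)"
  proof (rule has_derivative_inverse_basic[OF deriv _ _ _ assms(1,2)])
    show "(*v) B \<circ> (*v) ?A = id"
      by (auto simp: fun_eq_iff matrix_vector_mul_assoc B)
    show "isCont \<phi> w"
      using assms by (auto simp: lift_on_def continuous_on_eq_continuous_at)
  qed (use assms(3) in \<open>auto simp: lift_on_def\<close>)
  ultimately show thesis using that B by blast
qed

lemma covector_eigenvalue_bound:
  assumes "B ** A p = mat 1" and eig: "\<And>h. slope_fn m (B *v h) = \<mu> * slope_fn m h"
  shows "\<bar>\<mu>\<bar> < 2 / \<delta>"
proof (rule ccontr)
  assume "\<not> \<bar>\<mu>\<bar> < 2 / \<delta>"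
  then have "2 / \<delta> \<le> \<bar>\<mu>\<bar>" by simp
  moreover have "0 < 2 / \<delta>" using \<delta>_pos by simp
  ultimately have \<mu>: "\<mu> \<noteq> 0" "0 < \<bar>\<mu>\<bar>" by auto
  \<comment> \<open>The reciprocal of an eigenvalue of the inverse is an eigenvalue of \<open>A p\<close>; a large one would fall into the gap.\<close>
  define s where "s = 1 / \<mu>"
  have "2 \<le> \<bar>\<mu>\<bar> * \<delta>" using \<open>2 / \<delta> \<le> \<bar>\<mu>\<bar>\<close> \<delta>_pos by (simp add: field_simps)
  then have "\<bar>s\<bar> < \<delta>" using \<mu> by (simp add: s_def field_simps)
  have s: "slope_fn m (A p *v k) = s * slope_fn m k" for k
  proof -
    have "slope_fn m k = \<mu> * slope_fn m (A p *v k)"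
      using eig[of "A p *v k"] assms(1) by (simp add: matrix_vector_mul_assoc)
    then show ?thesis using \<mu> by (simp add: s_def)
  qed
  have "A p $ 1 $ 1 + m * A p $ 2 $ 1 = s" "A p $ 1 $ 2 + m * A p $ 2 $ 2 = s * m"
    using s[of "axis 1 1"] s[of "axis 2 1"] by (simp_all add: slope_fn_def matrix_vector_mult_2 axis_def)
  then have e: "A p $ 1 $ 1 = s - m * A p $ 2 $ 1" "A p $ 1 $ 2 = s * m - m * A p $ 2 $ 2"
    by (simp_all add: algebra_simps)
  have "det (A p - mat s) = 0"
    by (simp add: det_2 mat_def e algebra_simps)
  then show False using gap \<open>\<bar>s\<bar> < \<delta>\<close> by blast
qed

text \<open>The maximum principle behind the proof. Let \<open>w0\<close> maximise
  \<open>H = \<sigma> slope_fn m (\<phi> w) + \<kappa> slope_fn m w\<close>, with \<open>\<sigma> = \<plusminus> 1\<close>, over the region swept up to \<open>w\<close>.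
  If \<open>w0\<close> is not on the frame, the derivative of \<open>H\<close> vanishes along the sweeping line and is at most zero
  into the region, even if \<open>w0\<close> lies on the left side of the region. So it is \<open>\<nu> slope_fn m\<close> with
  \<open>\<nu> \<le> 0\<close>, and the functional \<open>slope_fn m\<close> is an eigenvector of the transposed derivative of \<open>\<phi>\<close> with
  eigenvalue \<open>\<sigma> (\<nu> - \<kappa>)\<close>, too large for the gap when \<open>\<kappa> = 2 / \<delta>\<close>.\<close>
lemma strip_bound:
  assumes lift: "lift_on G (open_strip m s) \<phi>" and m: "\<bar>m\<bar> \<le> \<eta>"
    and frame: "\<And>w. w \<in> open_strip m s \<Longrightarrow> w $ 2 = 0 \<or> w $ 2 = 1 \<or> - \<eta> \<le> slope_fn m w \<Longrightarrow>
      \<bar>slope_fn m (\<phi> w)\<bar> \<le> B"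
    and w: "w \<in> open_strip m s"
  shows "\<bar>slope_fn m (\<phi> w)\<bar> \<le> B + 2 / \<delta> * (\<eta> - s)"
proof -
  define \<kappa> where "\<kappa> = 2 / \<delta>"
  have "0 < \<kappa>" using \<delta>_pos by (simp add: \<kappa>_def)
  have "\<sigma> * slope_fn m (\<phi> w) \<le> B + \<kappa> * (\<eta> - s)" if \<sigma>: "\<bar>\<sigma>\<bar> = 1" for \<sigma> :: real
  proof -
    define C where "C = closed_strip m (slope_fn m w)"
    have CK: "C \<subseteq> open_strip m s" using w by (auto simp: C_def closed_strip_def open_strip_def)
    define H where "H w = \<sigma> * slope_fn m (\<phi> w) + \<kappa> * slope_fn m w" for w
    have "continuous_on C \<phi>" using lift CK by (auto simp: lift_on_def intro: continuous_on_subset)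
    then have "continuous_on C H" unfolding H_def by (intro continuous_intros)
    moreover have "compact C" by (simp add: C_def compact_closed_strip)
    moreover have "w \<in> C" using w by (auto simp: C_def closed_strip_def open_strip_def)
    ultimately obtain w0 where w0: "w0 \<in> C" "\<And>w. w \<in> C \<Longrightarrow> H w \<le> H w0"
      by (metis continuous_attains_sup empty_iff)
    have w0K: "w0 \<in> open_strip m s" using w0 CK by auto
    have band: "w0 $ 1 \<le> 0" "0 \<le> w0 $ 2" "w0 $ 2 \<le> 1" using w0(1) by (auto simp: C_def closed_strip_def half_band_def)
    have mv: "\<bar>m * w0 $ 2\<bar> \<le> \<eta>" using slope_term_bound[OF m] band by blast
    have "w0 $ 2 = 0 \<or> w0 $ 2 = 1 \<or> - \<eta> \<le> slope_fn m w0"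
    proof (rule ccontr)
      assume nf: "\<not> ?thesis"
      then have "w0 $ 1 < 0" using mv by (auto simp: slope_fn_def)
      then have int: "w0 \<in> interior half_band" using band nf by (intro interior_half_bandI) auto
      define N where "N = interior half_band \<inter> {w. s < slope_fn m w}"
      have "open N" unfolding N_def by (intro open_Int open_interior open_Collect_less continuous_intros)
      moreover have "w0 \<in> N" "N \<subseteq> open_strip m s"
        using int w0K interior_subset by (auto simp: N_def open_strip_def)
      ultimately obtain D where D: "(\<phi> has_derivative (*v) D) (at w0)" "D ** A (\<phi> w0) = mat 1"
        using lift_has_derivative[of N w0 \<phi>] lift_on_subset[OF lift] by metis
      have lin: "bounded_linear (slope_fn m)" using slope_fn_linear linear_conv_bounded_linear by blast
      define H' where "H' h = \<sigma> * slope_fn m (D *v h) + \<kappa> * slope_fn m h" for h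
      have dH: "(H has_derivative H') (at w0)"
        unfolding H_def H'_def
        by (intro derivative_intros bounded_linear.has_derivative[OF lin] D(1) has_derivative_ident)
      have nonpos: "H' d \<le> 0" if "0 \<le> slope_fn m d" for d
      proof -
        obtain e where e: "0 < e" "\<And>t. \<bar>t\<bar> < e \<Longrightarrow> w0 + t *\<^sub>R d \<in> interior half_band"
          using open_line_nbhd[OF open_interior int, of d] by blast
        have "H (w0 + t *\<^sub>R d) \<le> H w0" if "0 < t" "t < e" for t
          using e(2)[of t] that interior_subset[of half_band] w0(1) \<open>0 \<le> slope_fn m d\<close>
          by (intro w0(2)) (auto simp: C_def closed_strip_def intro: order_trans)
        then show ?thesis using directional_derivative_nonpos[OF dH e(1)] by simp
      qed
      interpret H': bounded_linear H' using dH by (rule has_derivative_bounded_linear)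
      define \<nu> where "\<nu> = H' (axis 1 1)"
      have "\<nu> \<le> 0" unfolding \<nu>_def by (rule nonpos) (simp add: slope_fn_def axis_def)
      have ker: "H' h = 0" if "slope_fn m h = 0" for h
        using nonpos[of h] nonpos[of "- h"] that by (simp add: H'.neg)
      have "H' h = \<nu> * slope_fn m h" for h
      proof -
        have "slope_fn m (axis 1 1 :: real ^ 2) = 1" by (simp add: slope_fn_def axis_def)
        then have "H' (h - slope_fn m h *\<^sub>R axis 1 1) = 0" by (intro ker) simp
        then show ?thesis by (simp add: H'.diff H'.scaleR \<nu>_def)
      qed
      then have "\<sigma> * slope_fn m (D *v h) = (\<nu> - \<kappa>) * slope_fn m h" for h
        unfolding H'_def by (simp add: algebra_simps)
      moreover have "\<sigma> * \<sigma> = 1" using \<sigma> by (metis abs_mult_self_eq mult_1)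
      ultimately have "slope_fn m (D *v h) = \<sigma> * (\<nu> - \<kappa>) * slope_fn m h" for h
        by (metis mult.assoc mult_1)
      then have "\<bar>\<sigma> * (\<nu> - \<kappa>)\<bar> < \<kappa>"
        unfolding \<kappa>_def using covector_eigenvalue_bound[OF D(2)] by blast
      then show False using \<sigma> \<open>\<nu> \<le> 0\<close> by (simp add: abs_mult)
    qed
    then have "\<bar>slope_fn m (\<phi> w0)\<bar> \<le> B" using frame w0K by blast
    then have "\<sigma> * slope_fn m (\<phi> w0) \<le> B" using \<sigma> abs_ge_self[of "\<sigma> * slope_fn m (\<phi> w0)"] by (simp add: abs_mult)
    moreover have "slope_fn m w0 \<le> \<eta>" using band mv by (simp add: slope_fn_def)
    then have "\<kappa> * (slope_fn m w0 - slope_fn m w) \<le> \<kappa> * (\<eta> - s)"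
      using w \<open>0 < \<kappa>\<close> by (intro mult_left_mono) (auto simp: open_strip_def)
    ultimately show ?thesis using w0(2)[OF \<open>w \<in> C\<close>] by (simp add: H_def algebra_simps)
  qed
  from this[of 1] this[of "-1"] show ?thesis by (simp add: \<kappa>_def abs_le_iff)
qed


text \<open>The sign \<open>\<sigma>\<close> covers spikes pointing up and spikes pointing down at once: \<open>- \<Phi>\<close> has the same
  Jacobian determinant as \<open>\<Phi>\<close>.\<close>
lemma three_strips_contradiction:
  assumes slopes: "m1 < m2" "m2 < m3" "\<bar>m2\<bar> \<le> \<eta>" and \<sigma>: "\<bar>\<sigma>\<bar> = 1"
    and lift: "lift_on G (open_strip m1 s1) \<Phi>" "lift_on G (open_strip m2 s2) \<Phi>" "lift_on G (open_strip m3 s3) \<Phi>"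
    and bound: "\<And>w. w \<in> open_strip m1 s1 \<Longrightarrow> \<bar>slope_fn m1 (\<Phi> w)\<bar> \<le> M"
      "\<And>w. w \<in> open_strip m2 s2 \<Longrightarrow> \<bar>slope_fn m2 (\<Phi> w)\<bar> \<le> M"
      "\<And>w. w \<in> open_strip m3 s3 \<Longrightarrow> \<bar>slope_fn m3 (\<Phi> w)\<bar> \<le> M"
    and frame: "\<And>w. w \<in> open_strip m2 s2 \<Longrightarrow> w $ 2 = 0 \<or> w $ 2 = 1 \<or> - \<eta> \<le> slope_fn m2 w \<Longrightarrow> \<bar>\<Phi> w $ 2\<bar> \<le> M"
    and spike: "\<And>R. \<exists>w\<in>open_strip m1 s1. R < \<sigma> * \<Phi> w $ 2"
      "\<And>R. \<exists>w\<in>open_strip m2 s2. R < \<sigma> * \<Phi> w $ 2" "\<And>R. \<exists>w\<in>open_strip m3 s3. R < \<sigma> * \<Phi> w $ 2"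
  shows False
proof (rule no_three_spikes[of m1 m2 m3 \<eta> s1 "\<lambda>w. \<sigma> *\<^sub>R \<Phi> w" s2 s3 M])
  show "continuous_on (open_strip m1 s1) (\<lambda>w. \<sigma> *\<^sub>R \<Phi> w)" "continuous_on (open_strip m2 s2) (\<lambda>w. \<sigma> *\<^sub>R \<Phi> w)"
    "continuous_on (open_strip m3 s3) (\<lambda>w. \<sigma> *\<^sub>R \<Phi> w)"
    using lift by (auto simp: lift_on_def intro!: continuous_intros)
  have "\<sigma> \<noteq> 0" using \<sigma> by auto
  have left_inv: "G (\<Phi> w) = w" if "w \<in> open_strip m1 s1 \<union> open_strip m2 s2 \<union> open_strip m3 s3" for w
    using lift that by (auto simp: lift_on_def)
  show "inj_on (\<lambda>w. \<sigma> *\<^sub>R \<Phi> w) (open_strip m1 s1 \<union> open_strip m2 s2 \<union> open_strip m3 s3)"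
  proof (rule inj_onI)
    fix x y
    assume xy: "x \<in> open_strip m1 s1 \<union> open_strip m2 s2 \<union> open_strip m3 s3"
      "y \<in> open_strip m1 s1 \<union> open_strip m2 s2 \<union> open_strip m3 s3" "\<sigma> *\<^sub>R \<Phi> x = \<sigma> *\<^sub>R \<Phi> y"
    then have "\<Phi> x = \<Phi> y" using \<open>\<sigma> \<noteq> 0\<close> by simp
    then show "x = y" using left_inv[OF xy(1)] left_inv[OF xy(2)] by metis
  qed
  show "\<exists>B. ((\<lambda>w. \<sigma> *\<^sub>R \<Phi> w) has_derivative (\<lambda>h. B *v h)) (at w) \<and> 0 < det B"
    if w: "w \<in> open_strip m2 s2" "w \<in> interior half_band" for w
  proof -
    define N where "N = interior half_band \<inter> {w. s2 < slope_fn m2 w}"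
    have "open N" unfolding N_def by (intro open_Int open_interior open_Collect_less continuous_intros)
    moreover have "w \<in> N" "N \<subseteq> open_strip m2 s2"
      using w interior_subset by (auto simp: N_def open_strip_def)
    ultimately obtain D where D: "(\<Phi> has_derivative (*v) D) (at w)" "0 < det D"
      using lift_has_derivative[of N w \<Phi>] lift_on_subset[OF lift(2)] by metis
    have "((\<lambda>w. \<sigma> *\<^sub>R \<Phi> w) has_derivative (\<lambda>h. (\<sigma> *\<^sub>R D) *v h)) (at w)"
      using has_derivative_scaleR_right[OF D(1), of \<sigma>] by (simp add: scaleR_matrix_vector_assoc)
    moreover have "det (\<sigma> *\<^sub>R D) = \<sigma> * \<sigma> * det D" by (simp add: det_2 algebra_simps)
    moreover have "\<sigma> * \<sigma> = 1" using \<sigma> by (metis abs_mult_self_eq mult_1)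
    ultimately show ?thesis using D(2) by (intro exI[of _ "\<sigma> *\<^sub>R D"]) simp
  qed
  show "\<bar>slope_fn m1 (\<sigma> *\<^sub>R \<Phi> w)\<bar> \<le> M" if "w \<in> open_strip m1 s1" for w
    using bound(1)[OF that] \<sigma> by (simp add: abs_mult)
  show "\<bar>slope_fn m2 (\<sigma> *\<^sub>R \<Phi> w)\<bar> \<le> M" if "w \<in> open_strip m2 s2" for w
    using bound(2)[OF that] \<sigma> by (simp add: abs_mult)
  show "\<bar>slope_fn m3 (\<sigma> *\<^sub>R \<Phi> w)\<bar> \<le> M" if "w \<in> open_strip m3 s3" for w
    using bound(3)[OF that] \<sigma> by (simp add: abs_mult)
  show "(\<sigma> *\<^sub>R \<Phi> w) $ 2 \<le> M" if "w \<in> open_strip m2 s2" "w $ 2 = 0 \<or> w $ 2 = 1 \<or> - \<eta> \<le> slope_fn m2 w" for w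
  proof -
    have "\<bar>\<sigma> * \<Phi> w $ 2\<bar> \<le> M" using frame[OF that] \<sigma> by (simp add: abs_mult)
    then show ?thesis by simp
  qed
qed (use slopes spike in auto)

text \<open>Lifts over three segments forming a frame that is open to the left fit together to a lift over the slanted
  segment inside the frame. Otherwise, for each small slope \<open>m\<close>, a lift over \<open>closed_strip m s\<close> exists
  for small negative \<open>s\<close> but not for \<open>s = - 2\<close>, as this region contains the slanted segment. At the critical
  level the lift over the open strip is unbounded, while on the frame it is bounded independently of the
  slope. By the maximum principle every slope in an interval yields a spike, up or down, and three of
  them in the same direction give a contradiction.\<close>
lemma frame_lift_fills:
  assumes edge: "lift_on G (closed_segment 0 (axis 2 1)) \<phi>e"
    and bottom: "lift_on G (closed_segment 0 (- 3 *\<^sub>R axis 1 1)) \<phi>b" "\<phi>b 0 = \<phi>e 0"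
    and top: "lift_on G (closed_segment (axis 2 1) (axis 2 1 - 3 *\<^sub>R axis 1 1)) \<phi>t" "\<phi>t (axis 2 1) = \<phi>e (axis 2 1)"
  shows "\<exists>\<phi>. lift_on G (closed_segment 0 (axis 2 1 - axis 1 1)) \<phi> \<and> \<phi> 0 = \<phi>e 0
    \<and> \<phi> (axis 2 1 - axis 1 1) = \<phi>t (axis 2 1 - axis 1 1)"
proof (rule ccontr)
  assume no_lift: "\<not> ?thesis"
  define E where "E = closed_segment 0 (axis 2 1 :: real ^ 2)"
  define bot where "bot = closed_segment 0 (- 3 *\<^sub>R axis 1 1 :: real ^ 2)"
  define tp where "tp = closed_segment (axis 2 1) (axis 2 1 - 3 *\<^sub>R axis 1 1 :: real ^ 2)"
  have ax: "(axis 1 1 :: real ^ 2) $ 1 = 1" "(axis 1 1 :: real ^ 2) $ 2 = 0"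
    "(axis 2 1 :: real ^ 2) $ 1 = 0" "(axis 2 1 :: real ^ 2) $ 2 = 1" by (simp_all add: axis_def)
  have Emem: "w \<in> E" if "w $ 1 = 0" "0 \<le> w $ 2" "w $ 2 \<le> 1" for w
    unfolding E_def closed_segment_def using that
    by (auto simp: vec_eq_iff forall_2 ax intro!: exI[of _ "w $ 2"])
  have botmem: "w \<in> bot" if "- 3 \<le> w $ 1" "w $ 1 \<le> 0" "w $ 2 = 0" for w
    unfolding bot_def closed_segment_def using that
    by (auto simp: vec_eq_iff forall_2 ax intro!: exI[of _ "- w $ 1 / 3"])
  have tpmem: "w \<in> tp" if "- 3 \<le> w $ 1" "w $ 1 \<le> 0" "w $ 2 = 1" for w
    unfolding tp_def closed_segment_def using that
    by (auto simp: vec_eq_iff forall_2 ax intro!: exI[of _ "- w $ 1 / 3"])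
  define good where "good K \<longleftrightarrow> (\<exists>\<phi>. lift_on G K \<phi> \<and> \<phi> 0 = \<phi>e 0)" for K
  have good_sub: "good L" if "good K" "L \<subseteq> K" for K L using that lift_on_subset unfolding good_def by blast
  obtain \<Phi> where \<Phi>: "\<And>K \<phi> w. convex K \<Longrightarrow> 0 \<in> K \<Longrightarrow> lift_on G K \<phi> \<Longrightarrow> \<phi> 0 = \<phi>e 0 \<Longrightarrow> w \<in> K \<Longrightarrow> \<Phi> w = \<phi> w"
    using common_lift[of 0 "\<phi>e 0"] by metis
  have \<Phi>_lift: "lift_on G K \<Phi>" if "convex K" "0 \<in> K" "good K" for K
    using \<Phi>[OF that(1,2)] that(3) unfolding good_def lift_on_def by (metis (no_types, lifting) continuous_on_cong)
  have \<Phi>0: "\<Phi> 0 = \<phi>e 0" using \<Phi>[of E \<phi>e 0] edge by (auto simp: E_def)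
  note convc = convex_closed_strip and compc = compact_closed_strip and convo = convex_open_strip
  have zero: "0 \<in> closed_strip m s" if "s \<le> 0" for m s
    using that by (simp add: closed_strip_def half_band_def slope_fn_def)
  have zeroo: "0 \<in> open_strip m s" if "s < 0" for m s
    using that by (simp add: open_strip_def half_band_def slope_fn_def)
  have "compact E" by (simp add: E_def)
  from lift_extend_nbhd[OF this edge[folded E_def]] obtain e \<psi> where e: "e > 0" "lift_on G (\<Union>k\<in>E. ball k e) \<psi>"
    "\<And>w. w \<in> E \<Longrightarrow> \<psi> w = \<phi>e w" by blast
  define \<eta> where "\<eta> = min (e / 4) (1 / 4)"
  have \<eta>: "0 < \<eta>" "2 * \<eta> < e" "\<eta> \<le> 1 / 4" using e(1) by (auto simp: \<eta>_def)
  \<comment> \<open>A thin rectangle along the edge over which the lift exists. It contains the beginning of the sweep for all slopes of modulus at most \<open>\<eta> / 2\<close>.\<close>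
  define R where "R = closed_strip 0 (- 2 * \<eta>)"
  have "R \<subseteq> (\<Union>k\<in>E. ball k e)"
  proof
    fix w assume "w \<in> R"
    then have w: "w $ 1 \<le> 0" "0 \<le> w $ 2" "w $ 2 \<le> 1" "- 2 * \<eta> \<le> w $ 1"
      by (auto simp: R_def closed_strip_def half_band_def slope_fn_def)
    let ?k = "w - (w $ 1) *\<^sub>R axis 1 1"
    have "?k \<in> E" using w by (intro Emem) (auto simp: ax)
    moreover have "dist ?k w < e" using w \<eta> by (simp add: dist_norm)
    ultimately show "w \<in> (\<Union>k\<in>E. ball k e)" by (auto intro!: bexI[of _ ?k])
  qed
  then have goodR: "good R"
    unfolding good_def using e(2,3) lift_on_subset by (metis E_def ends_in_segment(1))
  have mv: "\<bar>m * w $ 2\<bar> \<le> \<eta> / 2" if "\<bar>m\<bar> \<le> \<eta> / 2" "w \<in> half_band" for m w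
    using slope_term_bound[OF that(1)] that(2) by (auto simp: half_band_def)
  have inR: "closed_strip m (- \<eta>) \<subseteq> R" if "\<bar>m\<bar> \<le> \<eta> / 2" for m
    using mv[OF that] \<eta> by (fastforce simp: R_def closed_strip_def slope_fn_def)
  have bad: "\<not> good (closed_strip m (- 2))" if m: "\<bar>m\<bar> \<le> \<eta> / 2" for m
  proof
    let ?K = "closed_strip m (- 2)"
    assume "good ?K"
    then have l: "lift_on G ?K \<Phi>" using \<Phi>_lift convc zero by auto
    have a: "axis 2 1 \<in> ?K" "axis 2 1 - axis 1 1 \<in> ?K"
      using m \<eta> by (auto simp: closed_strip_def half_band_def slope_fn_def ax)
    have segK: "closed_segment (axis 2 1) (axis 2 1 - axis 1 1) \<subseteq> ?K" "closed_segment 0 (axis 2 1 - axis 1 1) \<subseteq> ?K"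
      using a zero[of "-2" m] convc by (simp_all add: closed_segment_subset)
    have "convex tp" "axis 2 1 \<in> tp" "axis 2 1 - axis 1 1 \<in> tp"
      by (auto simp: tp_def intro!: tpmem[unfolded tp_def]  simp: ax)
    then have segt: "closed_segment (axis 2 1) (axis 2 1 - axis 1 1) \<subseteq> tp" by (intro closed_segment_subset)
    have "\<Phi> (axis 2 1 - axis 1 1) = \<phi>t (axis 2 1 - axis 1 1)"
    proof (rule lift_unique[where X = "closed_segment (axis 2 1) (axis 2 1 - axis 1 1)" and a = "axis 2 1" and \<phi> = \<Phi> and \<psi> = \<phi>t])
      show "\<Phi> (axis 2 1) = \<phi>t (axis 2 1)"
        using \<Phi>[of E \<phi>e "axis 2 1"] edge top(2) by (auto simp: E_def)
    qed (use lift_on_subset[OF l segK(1)] lift_on_subset[OF top(1)[folded tp_def] segt] in auto)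
    then show False using no_lift lift_on_subset[OF l segK(2)] \<Phi>0 by blast
  qed
  have sweep: "\<exists>s. - 2 \<le> s \<and> s \<le> - \<eta> \<and> lift_on G (open_strip m s) \<Phi> \<and> \<not> bounded (\<Phi> ` open_strip m s)"
    if m: "\<bar>m\<bar> \<le> \<eta> / 2" for m
  proof -
    define S where "S = {s. s \<le> - \<eta> \<and> good (closed_strip m s)}"
    have "- \<eta> \<in> S" using good_sub[OF goodR inR[OF m]] by (simp add: S_def)
    have low: "- 2 \<le> s" if "s \<in> S" for s
    proof (rule ccontr)
      assume "\<not> - 2 \<le> s"
      then have "closed_strip m (- 2) \<subseteq> closed_strip m s" by (auto simp: closed_strip_def)
      then show False using bad[OF m] good_sub that by (auto simp: S_def)
    qed
    then have bdd: "bdd_below S" by (meson bdd_belowI)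
    define s0 where "s0 = Inf S"
    have s0: "- 2 \<le> s0" "s0 \<le> - \<eta>"
      using \<open>- \<eta> \<in> S\<close> low bdd by (auto simp: s0_def intro: cInf_lower cInf_greatest)
    have above: "good (closed_strip m s)" if "s0 < s" for s
    proof -
      have "S \<noteq> {}" using \<open>- \<eta> \<in> S\<close> by blast
      then obtain s' where "s' \<in> S" "s' < s" using \<open>s0 < s\<close> cInf_lessD[of S s] unfolding s0_def by blast
      moreover have "closed_strip m s \<subseteq> closed_strip m s'" using \<open>s' < s\<close> by (auto simp: closed_strip_def)
      ultimately show ?thesis using good_sub by (auto simp: S_def)
    qed
    \<comment> \<open>Otherwise the lift would extend slightly beyond the critical level, because a closed strip is compact.\<close>
    have not_good: "\<not> good (closed_strip m s0)"
    proof
      assume "good (closed_strip m s0)"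
      then obtain \<phi> where \<phi>: "lift_on G (closed_strip m s0) \<phi>" "\<phi> 0 = \<phi>e 0" by (auto simp: good_def)
      from lift_extend_nbhd[OF compc \<phi>(1)] obtain d \<zeta> where d: "d > 0"
        "lift_on G (\<Union>k\<in>closed_strip m s0. ball k d) \<zeta>" "\<And>w. w \<in> closed_strip m s0 \<Longrightarrow> \<zeta> w = \<phi> w" by blast
      define \<epsilon> where "\<epsilon> = min (d / 2) (\<eta> / 2)"
      have \<epsilon>: "0 < \<epsilon>" "\<epsilon> < d" "\<epsilon> \<le> \<eta> / 2" using d(1) \<eta> by (auto simp: \<epsilon>_def)
      have "closed_strip m (s0 - \<epsilon>) \<subseteq> (\<Union>k\<in>closed_strip m s0. ball k d)"
      proof
        fix w assume w: "w \<in> closed_strip m (s0 - \<epsilon>)"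
        show "w \<in> (\<Union>k\<in>closed_strip m s0. ball k d)"
        proof (cases "w \<in> closed_strip m s0")
          case True
          then show ?thesis using d(1) by (intro UN_I[of w]) auto
        next
          case False
          let ?k = "w + \<epsilon> *\<^sub>R axis 1 1"
          have "w $ 1 < - \<eta> / 2"
            using False w s0 mv[OF m, of w] by (auto simp: closed_strip_def slope_fn_def)
          then have "?k \<in> closed_strip m s0"
            using w \<epsilon> by (auto simp: closed_strip_def half_band_def slope_fn_def ax)
          moreover have "dist ?k w < d" using \<epsilon> by (simp add: dist_norm)
          ultimately show ?thesis by (auto intro!: bexI[of _ ?k])
        qed
      qed
      then have "lift_on G (closed_strip m (s0 - \<epsilon>)) \<zeta>" using d(2) lift_on_subset by blast
      moreover have "\<zeta> 0 = \<phi>e 0" using d(3) \<phi>(2) zero s0 \<eta> by simp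
      ultimately have "s0 - \<epsilon> \<in> S" using s0 \<epsilon> by (auto simp: S_def good_def)
      then have "s0 \<le> s0 - \<epsilon>" unfolding s0_def using bdd by (rule cInf_lower)
      then show False using \<epsilon> by simp
    qed
    have lift: "lift_on G (open_strip m s0) \<Phi>"
      unfolding lift_on_def continuous_on_eq_continuous_within
    proof (intro conjI ballI)
      fix w assume w: "w \<in> open_strip m s0"
      define s where "s = (s0 + min 0 (slope_fn m w)) / 2"
      have s: "s0 < s" "s < 0" "s < slope_fn m w"
        using w s0 \<eta> by (auto simp: s_def open_strip_def min_def)
      have l: "lift_on G (closed_strip m s) \<Phi>"
        using \<Phi>_lift[OF convc zero above] s by simp
      have wc: "w \<in> closed_strip m s" using w s by (auto simp: closed_strip_def open_strip_def)
      then show "G (\<Phi> w) = w" using l by (simp add: lift_on_def)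
      have "continuous (at w within closed_strip m s) \<Phi>"
        using l wc by (auto simp: lift_on_def continuous_on_eq_continuous_within)
      moreover have "at w within open_strip m s0 = at w within closed_strip m s"
      proof (rule at_within_nhd[where S = "{w. s < slope_fn m w}"])
        show "open {w. s < slope_fn m w}" by (intro open_Collect_less continuous_intros)
      qed (use s in \<open>auto simp: open_strip_def closed_strip_def\<close>)
      ultimately show "continuous (at w within open_strip m s0) \<Phi>" by simp
    qed
    \<comment> \<open>A bounded lift would extend to the closure, contrary to the choice of the level.\<close>
    have "\<not> bounded (\<Phi> ` open_strip m s0)"
    proof
      assume "bounded (\<Phi> ` open_strip m s0)"
      from lift_extend_closure[OF convo lift this] obtain \<zeta> where
        \<zeta>: "lift_on G (closure (open_strip m s0)) \<zeta>" "\<And>w. w \<in> open_strip m s0 \<Longrightarrow> \<zeta> w = \<Phi> w" by blast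
      have "closed_strip m s0 \<subseteq> closure (open_strip m s0)"
      proof
        fix w assume w: "w \<in> closed_strip m s0"
        have "(1 - t) *\<^sub>R w \<in> open_strip m s0" if t: "0 < t" "t \<le> 1" for t
        proof -
          have "(1 - t) * s0 \<le> (1 - t) * slope_fn m w" using w t by (intro mult_left_mono) (auto simp: closed_strip_def)
          moreover have "s0 < (1 - t) * s0" using t s0 \<eta> mult_pos_neg[of t s0] by (simp add: algebra_simps)
          ultimately have "s0 < slope_fn m ((1 - t) *\<^sub>R w)" by simp
          moreover have "(1 - t) *\<^sub>R w \<in> half_band"
            using w t by (auto simp: closed_strip_def half_band_def mult_nonneg_nonpos mult_le_one)
          ultimately show ?thesis by (simp add: open_strip_def)
        qed
        then have "\<forall>\<^sub>F t in at_right 0. (1 - t) *\<^sub>R w \<in> open_strip m s0"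
          unfolding eventually_at_right_field by (intro exI[of _ 1]) auto
        then have "\<forall>\<^sub>F t in at_right 0. (1 - t) *\<^sub>R w \<in> closure (open_strip m s0)"
          by (rule eventually_mono) (use closure_subset in blast)
        moreover have "((\<lambda>t. (1 - t) *\<^sub>R w) \<longlongrightarrow> (1 - 0) *\<^sub>R w) (at_right 0)"
          by (intro tendsto_intros)
        ultimately show "w \<in> closure (open_strip m s0)"
          using Lim_in_closed_set[OF closed_closure] by force
      qed
      moreover have "\<zeta> 0 = \<phi>e 0"
        using \<zeta>(2)[of 0] zeroo s0 \<eta> \<Phi>0 by auto
      ultimately show False using \<zeta>(1) lift_on_subset not_good unfolding good_def by blast
    qed
    then show ?thesis using lift s0 \<eta> by (intro exI[of _ s0]) auto
  qed
  have "compact R" by (simp add: R_def compc)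
  moreover have "compact bot" "compact tp" by (simp_all add: bot_def tp_def)
  moreover have "lift_on G R \<Phi>" using \<Phi>_lift convc zero goodR \<eta> by (simp add: R_def)
  moreover have "lift_on G bot \<Phi>" using \<Phi>_lift bottom by (auto simp: bot_def good_def)
  moreover have "lift_on G tp \<phi>t" using top by (simp add: tp_def)
  ultimately have "bounded (\<Phi> ` R \<union> \<Phi> ` bot \<union> \<phi>t ` tp)"
    unfolding lift_on_def by (intro bounded_Un[THEN iffD2] conjI compact_imp_bounded compact_continuous_image) auto
  then obtain B where "\<And>p. p \<in> \<Phi> ` R \<union> \<Phi> ` bot \<union> \<phi>t ` tp \<Longrightarrow> norm p \<le> B"
    unfolding bounded_iff by blast
  then have B: "w \<in> R \<Longrightarrow> norm (\<Phi> w) \<le> B" "w \<in> bot \<Longrightarrow> norm (\<Phi> w) \<le> B" "w \<in> tp \<Longrightarrow> norm (\<phi>t w) \<le> B" for w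
    by auto
  have "0 \<in> R" using zero \<eta> by (simp add: R_def)
  then have "0 \<le> B" using B(1) norm_ge_zero order_trans by blast
  have frame: "norm (\<Phi> w) \<le> B"
    if m: "\<bar>m\<bar> \<le> \<eta> / 2" and s: "- 2 \<le> s" "s \<le> - \<eta>" and l: "lift_on G (open_strip m s) \<Phi>"
      and w: "w \<in> open_strip m s" "w $ 2 = 0 \<or> w $ 2 = 1 \<or> - \<eta> \<le> slope_fn m w" for m s w
  proof -
    have wb: "w \<in> half_band" "w $ 1 \<le> 0" using w by (auto simp: open_strip_def half_band_def)
    have u: "- 3 \<le> w $ 1" using w(1) s mv[OF m wb(1)] \<eta> by (auto simp: open_strip_def slope_fn_def)
    consider "w $ 2 = 0" | "w $ 2 = 1" | "- \<eta> \<le> slope_fn m w" using w(2) by blast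
    then show ?thesis
    proof cases
      case 1
      then show ?thesis using B(2) botmem u wb by blast
    next
      case 2
      have wt: "w \<in> tp" and et: "axis 2 1 \<in> tp" using tpmem 2 u wb by (auto simp: tp_def)
      have eo: "axis 2 1 \<in> open_strip m s"
        using m s \<eta> by (auto simp: open_strip_def half_band_def slope_fn_def ax)
      have "\<Phi> w = \<phi>t w"
      proof (rule lift_unique[where X = "closed_segment (axis 2 1) w" and a = "axis 2 1" and \<phi> = \<Phi> and \<psi> = \<phi>t])
        show "\<Phi> (axis 2 1) = \<phi>t (axis 2 1)"
          using \<Phi>[of E \<phi>e "axis 2 1"] edge top(2) by (auto simp: E_def)
        show "lift_on G (closed_segment (axis 2 1) w) \<Phi>"
          using lift_on_subset[OF l] closed_segment_subset[OF eo w(1) convo] .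
        have "convex tp" by (simp add: tp_def)
        then show "lift_on G (closed_segment (axis 2 1) w) \<phi>t"
          using lift_on_subset[OF top(1)[folded tp_def]] closed_segment_subset[OF et wt] by blast
      qed auto
      then show ?thesis using B(3)[OF wt] by simp
    next
      case 3
      then have "w \<in> R" using inR[OF m] wb by (auto simp: closed_strip_def)
      then show ?thesis by (rule B(1))
    qed
  qed
  \<comment> \<open>The same bound for all slopes, since no critical level is below \<open>- 2\<close>.\<close>
  define M where "M = 2 * B + 2 / \<delta> * (\<eta> + 2)"
  have "B \<le> M" using \<open>0 \<le> B\<close> \<delta>_pos \<eta> by (simp add: M_def)
  have bound: "\<bar>slope_fn m (\<Phi> w)\<bar> \<le> M"
    if m: "\<bar>m\<bar> \<le> \<eta> / 2" and s: "- 2 \<le> s" "s \<le> - \<eta>" and l: "lift_on G (open_strip m s) \<Phi>"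
      and w: "w \<in> open_strip m s" for m s w
  proof -
    have "\<bar>slope_fn m (\<Phi> w)\<bar> \<le> 2 * B + 2 / \<delta> * (\<eta> - s)"
    proof (rule strip_bound[OF l _ _ w])
      show "\<bar>m\<bar> \<le> \<eta>" using m \<eta> by simp
      fix w assume w: "w \<in> open_strip m s" "w $ 2 = 0 \<or> w $ 2 = 1 \<or> - \<eta> \<le> slope_fn m w"
      have n: "norm (\<Phi> w) \<le> B" using frame[OF m s l w] .
      have "\<bar>\<Phi> w $ 1\<bar> \<le> B" "\<bar>\<Phi> w $ 2\<bar> \<le> B" using n component_le_norm_cart order_trans by blast+
      moreover have "\<bar>m * \<Phi> w $ 2\<bar> \<le> 1 * B"
        unfolding abs_mult using m \<eta> calculation by (intro mult_mono) auto
      ultimately show "\<bar>slope_fn m (\<Phi> w)\<bar> \<le> 2 * B" unfolding slope_fn_def by linarith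
    qed
    also have "\<dots> \<le> M" unfolding M_def using s \<delta>_pos by (intro add_left_mono mult_left_mono) auto
    finally show ?thesis .
  qed
  obtain sm where sm: "\<And>m. \<bar>m\<bar> \<le> \<eta> / 2 \<Longrightarrow> - 2 \<le> sm m \<and> sm m \<le> - \<eta> \<and> lift_on G (open_strip m (sm m)) \<Phi>
      \<and> \<not> bounded (\<Phi> ` open_strip m (sm m))"
    using sweep by metis
  define spike where "spike \<sigma> m \<longleftrightarrow> (\<forall>R. \<exists>w\<in>open_strip m (sm m). R < \<sigma> * \<Phi> w $ 2)" for \<sigma> m :: real
  have up_or_down: "spike 1 m \<or> spike (-1) m" if m: "\<bar>m\<bar> \<le> \<eta> / 2" for m
  proof (rule ccontr)
    assume "\<not> ?thesis"
    then obtain R1 R2 where R: "\<And>w. w \<in> open_strip m (sm m) \<Longrightarrow> \<Phi> w $ 2 \<le> R1"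
      "\<And>w. w \<in> open_strip m (sm m) \<Longrightarrow> - \<Phi> w $ 2 \<le> R2"
      unfolding spike_def by (auto simp: not_less)
    define r where "r = max R1 R2"
    have "norm (\<Phi> w) \<le> M + 2 * r" if w: "w \<in> open_strip m (sm m)" for w
    proof -
      have y: "\<bar>\<Phi> w $ 2\<bar> \<le> r" using R[OF w] by (auto simp: r_def)
      moreover have "\<bar>m * \<Phi> w $ 2\<bar> \<le> 1 * r"
        unfolding abs_mult using m \<eta> y by (intro mult_mono) auto
      moreover have "\<bar>\<Phi> w $ 1 + m * \<Phi> w $ 2\<bar> \<le> M" using bound[OF m _ _ _ w] sm[OF m] by (simp add: slope_fn_def)
      ultimately have "\<bar>\<Phi> w $ 1\<bar> + \<bar>\<Phi> w $ 2\<bar> \<le> M + 2 * r" by linarith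
      then show ?thesis using norm_le_l1_cart[of "\<Phi> w"] by (simp add: sum_2)
    qed
    then have "bounded (\<Phi> ` open_strip m (sm m))" unfolding bounded_iff by blast
    then show False using sm[OF m] by blast
  qed
  have no3: "\<not> (spike \<sigma> a \<and> spike \<sigma> b \<and> spike \<sigma> c)"
    if \<sigma>: "\<bar>\<sigma>\<bar> = 1" and abc: "a < b" "b < c" "\<bar>a\<bar> \<le> \<eta> / 2" "\<bar>b\<bar> \<le> \<eta> / 2" "\<bar>c\<bar> \<le> \<eta> / 2" for \<sigma> a b c
  proof
    assume sp: "spike \<sigma> a \<and> spike \<sigma> b \<and> spike \<sigma> c"
    show False
    proof (rule three_strips_contradiction[OF abc(1,2) _ \<sigma>, of \<eta> "sm a" \<Phi> "sm b" "sm c" M])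
      show "\<bar>\<Phi> w $ 2\<bar> \<le> M" if w: "w \<in> open_strip b (sm b)" "w $ 2 = 0 \<or> w $ 2 = 1 \<or> - \<eta> \<le> slope_fn b w" for w
        using frame[OF abc(4) _ _ _ w] sm[OF abc(4)] component_le_norm_cart[of "\<Phi> w" 2] \<open>B \<le> M\<close> by linarith
    qed (use sp sm abc bound \<eta> in \<open>auto simp: spike_def\<close>)
  qed
  define S where "S \<sigma> = {m. \<bar>m\<bar> \<le> \<eta> / 2 \<and> spike \<sigma> m}" for \<sigma>
  have "finite (S \<sigma>)" if "\<bar>\<sigma>\<bar> = 1" for \<sigma>
  proof (rule ccontr)
    assume "infinite (S \<sigma>)"
    then obtain a b c where "a \<in> S \<sigma>" "b \<in> S \<sigma>" "c \<in> S \<sigma>" "a < b" "b < c"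
      using infinite_imp_ordered_triple by metis
    then show False using no3[OF that, of a b c] by (auto simp: S_def)
  qed
  then have "finite (S 1 \<union> S (-1))" by simp
  moreover have "{- \<eta> / 2..\<eta> / 2} \<subseteq> S 1 \<union> S (-1)"
  proof
    fix m assume "m \<in> {- \<eta> / 2..\<eta> / 2}"
    then have "\<bar>m\<bar> \<le> \<eta> / 2" by auto
    then show "m \<in> S 1 \<union> S (-1)" using up_or_down by (auto simp: S_def)
  qed
  ultimately have "finite {- \<eta> / 2..\<eta> / 2}" by (rule finite_subset[rotated])
  then show False using infinite_Icc[of "- \<eta> / 2" "\<eta> / 2"] \<eta>(1) by simp
qed



end

section \<open>Injectivity from the spectral gap\<close>

text \<open>Conjugation by a linear map preserves the characteristic polynomial of the derivative.\<close>
lemma (in spectral_gap_map) conjugate: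
  assumes ST: "S ** T = mat 1" "T ** S = mat 1"
  shows "spectral_gap_map (\<lambda>p. T *v (G (S *v p) - c)) (\<lambda>p. T ** A (S *v p) ** S) \<delta>"
proof
  have ST': "S *v (T *v x) = x" "T *v (S *v x) = x" for x
    by (simp_all add: matrix_vector_mul_assoc ST)
  have detST: "det T * det S = 1" using arg_cong[OF ST(2), of det] by (simp add: det_mul)
  show "continuous_on UNIV (\<lambda>p. T *v (G (S *v p) - c))"
    by (intro matrix_vector_mult_linear_continuous_on[THEN continuous_on_compose2[where s = UNIV]]
        continuous_intros continuous_on_compose2[OF cont]) auto
  show "\<exists>e>0. inj_on (\<lambda>p. T *v (G (S *v p) - c)) (ball p e)" for p
  proof -
    obtain r where r: "r > 0" "inj_on G (ball (S *v p) r)" using locally_inj by blast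
    have "open ((\<lambda>x. S *v x) -` ball (S *v p) r)"
      by (intro open_vimage matrix_vector_mult_linear_continuous_on) auto
    then obtain e where e: "e > 0" "ball p e \<subseteq> (\<lambda>x. S *v x) -` ball (S *v p) r"
      using r(1) open_contains_ball by (metis centre_in_ball vimageI)
    have "inj_on (\<lambda>p. T *v (G (S *v p) - c)) (ball p e)"
    proof (rule inj_onI)
      fix x y assume xy: "x \<in> ball p e" "y \<in> ball p e" "T *v (G (S *v x) - c) = T *v (G (S *v y) - c)"
      have "S *v (T *v (G (S *v x) - c)) = S *v (T *v (G (S *v y) - c))" by (simp only: xy(3))
      then have "G (S *v x) = G (S *v y)" by (simp add: ST'(1))
      moreover have "S *v x \<in> ball (S *v p) r" "S *v y \<in> ball (S *v p) r" using xy(1,2) e(2) by blast+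
      ultimately have "S *v x = S *v y" using inj_onD[OF r(2)] by blast
      then show "x = y" using ST'(2) by metis
    qed
    then show ?thesis using e by blast
  qed
  show "((\<lambda>p. T *v (G (S *v p) - c)) has_derivative (*v) (T ** A (S *v p) ** S)) (at p)" for p
  proof -
    have "((\<lambda>p. S *v p) has_derivative (*v) S) (at p)"
      by (rule bounded_linear_imp_has_derivative) simp
    from has_derivative_compose[OF this deriv]
    have "((\<lambda>p. G (S *v p)) has_derivative (\<lambda>h. A (S *v p) *v (S *v h))) (at p)" .
    then have "((\<lambda>p. G (S *v p) - c) has_derivative (\<lambda>h. A (S *v p) *v (S *v h) - 0)) (at p)"
      by (intro derivative_intros)
    from bounded_linear.has_derivative[OF matrix_vector_mul_bounded_linear this, of T]
    show ?thesis by (simp add: matrix_vector_mul_assoc matrix_mul_assoc)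
  qed
  have det_conj: "det (T ** M ** S) = det M" for M :: "real ^ 2 ^ 2"
  proof -
    have "det (T ** M ** S) = det M * (det T * det S)" by (simp add: det_mul)
    then show ?thesis by (simp add: detST)
  qed
  show "0 < det (T ** A (S *v p) ** S)" for p using det_conj det_pos by simp
  show "0 < \<delta>" by (rule \<delta>_pos)
  show "det (T ** A (S *v p) ** S - mat s) \<noteq> 0" if "\<bar>s\<bar> < \<delta>" for s p
  proof -
    have "T ** A (S *v p) ** S - mat s = T ** (A (S *v p) - mat s) ** S"
      unfolding matrix_eq
      by (simp add: matrix_vector_mul_assoc[symmetric] matrix_vector_mult_diff_rdistrib
          matrix_vector_mult_diff_distrib mat_mult_vec matrix_vector_mult_scaleR ST')
    then show ?thesis using det_conj gap[OF that] by simp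
  qed
qed


text \<open>Near a boundary point \<open>b\<close> of the visible set choose a visible point \<open>z\<close> with \<open>G z\<close> off the line through
  \<open>w0 = G p\<close> and \<open>w1 = G b\<close>. The coordinate change \<open>w \<mapsto> S w + w0\<close> takes the vertical edge to the
  lifted segment from \<open>w0\<close> to \<open>e = G z\<close>, and its linear part takes \<open>(-1, 0)\<close> to the small vector
  \<open>d = w1 - e\<close>. The horizontal sides of the frame,
  of length three, then stay inside the balls around \<open>w0\<close> and \<open>w1\<close> over which local branches of the
  inverse exist. The slanted segment becomes the one from \<open>w0\<close> to \<open>w1\<close>, and lifting it makes
  \<open>b\<close> visible.\<close>
theorem (in spectral_gap_map) injective: "inj G"
proof (rule ccontr)
  assume "\<not> inj G"
  then obtain p q where pq: "p \<noteq> q" "G p = G q" by (auto simp: inj_def)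
  have "q \<notin> segment_visible p"
    using pq by (auto simp: segment_visible_def)
  then have "\<not> closed (segment_visible p)"
    using open_segment_visible[of p] segment_visible_self[of p] clopen[of "segment_visible p"] by auto
  then obtain b where b: "b \<in> closure (segment_visible p)" "b \<notin> segment_visible p"
    by (metis closure_subset closure_eq subsetI subset_antisym)
  define w0 where "w0 = G p"
  define w1 where "w1 = G b"
  have ne: "w1 \<noteq> w0" using frontier_point_image_ne[OF b] by (simp add: w0_def w1_def)
  obtain r0 \<psi>0 where \<psi>0: "r0 > 0" "lift_on G (ball w0 r0) \<psi>0" "\<psi>0 w0 = p" using local_lift unfolding w0_def by blast
  obtain r1 \<psi>1 where \<psi>1: "r1 > 0" "lift_on G (ball w1 r1) \<psi>1" "\<psi>1 w1 = b" using local_lift unfolding w1_def by blast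
  define r where "r = min r0 r1 / 4"
  have r: "0 < r" "4 * r \<le> r0" "4 * r \<le> r1" using \<psi>0 \<psi>1 by (auto simp: r_def)
  have "\<forall>\<^sub>F x in nhds b. G x \<in> ball w1 r1 \<and> \<psi>1 (G x) = x"
    by (rule lift_inverts_near) (use \<psi>1 in \<open>auto simp: w1_def\<close>)
  moreover have "\<forall>\<^sub>F x in nhds b. G x \<in> ball w1 r"
    using isCont_G r(1) by (intro topological_tendstoD[of G "G b"]) (auto simp: continuous_at tendsto_nhds_iff w1_def)
  ultimately have "\<forall>\<^sub>F x in nhds b. G x \<in> ball w1 r \<and> \<psi>1 (G x) = x" by eventually_elim auto
  then obtain V where V: "open V" "b \<in> V" "\<And>x. x \<in> V \<Longrightarrow> G x \<in> ball w1 r \<and> \<psi>1 (G x) = x"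
    unfolding eventually_nhds by blast
  define cross :: "real ^ 2 \<Rightarrow> real ^ 2 \<Rightarrow> real" where "cross x y = x $ 1 * y $ 2 - x $ 2 * y $ 1" for x y
  have "\<exists>z \<in> V \<inter> segment_visible p. cross (G z - w0) (w1 - w0) \<noteq> 0"
  proof -
    obtain z where z: "z \<in> V \<inter> segment_visible p" using b(1) V closure_iff_nhds_not_empty by blast
    show ?thesis
    proof (cases "cross (G z - w0) (w1 - w0) = 0")
      case True
      define d :: "real ^ 2" where "d = (w1 - w0) $ 2 *\<^sub>R axis 1 1 - (w1 - w0) $ 1 *\<^sub>R axis 2 1"
      have d: "d $ 1 = (w1 - w0) $ 2" "d $ 2 = - (w1 - w0) $ 1" by (simp_all add: d_def axis_def)
      have "cross d (w1 - w0) = ((w1 - w0) $ 1)\<^sup>2 + ((w1 - w0) $ 2)\<^sup>2"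
        unfolding cross_def d power2_eq_square by (simp add: algebra_simps)
      moreover have "(w1 - w0) $ 1 \<noteq> 0 \<or> (w1 - w0) $ 2 \<noteq> 0"
        using ne by (auto simp: vec_eq_iff forall_2)
      ultimately have "cross d (w1 - w0) > 0" by (simp only: sum_power2_gt_zero_iff)
      obtain z' t where z': "z' \<in> V \<inter> segment_visible p" "t \<noteq> 0" "G z' = G z + t *\<^sub>R d"
        using image_moves_in_direction[OF open_Int[OF V(1) open_segment_visible] z, of d] by blast
      have "cross (G z' - w0) (w1 - w0) = cross (G z - w0) (w1 - w0) + t * cross d (w1 - w0)"
        unfolding z'(3) by (simp add: cross_def algebra_simps)
      then show ?thesis using True z' \<open>cross d (w1 - w0) > 0\<close> by (intro bexI[of _ z']) auto
    qed (use z in blast)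
  qed
  then obtain z where z: "z \<in> V" "z \<in> segment_visible p" "cross (G z - w0) (w1 - w0) \<noteq> 0" by blast
  define e where "e = G z"
  define d where "d = w1 - e"
  have d: "norm d < r" "\<psi>1 e = z" using V(3)[OF z(1)] by (auto simp: d_def e_def dist_norm)
  obtain \<phi> where \<phi>: "lift_on G (closed_segment w0 e) \<phi>" "\<phi> w0 = p" "\<phi> e = z"
    using z(2) by (auto simp: segment_visible_def w0_def e_def)
  define S :: "real ^ 2 ^ 2" where "S = (\<chi> i j. if j = 1 then - d $ i else (e - w0) $ i)"
  have S1: "S *v axis 1 1 = - d" and S2: "S *v axis 2 1 = e - w0"
    by (simp_all add: vec_eq_iff forall_2 matrix_vector_mult_2 S_def axis_def)
  have "det S \<noteq> 0"
    using z(3) by (simp add: det_2 S_def cross_def d_def e_def[symmetric] algebra_simps)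
  then obtain T where ST: "S ** T = mat 1" "T ** S = mat 1"
    using invertible_det_nz[of S] unfolding invertible_def by blast
  have ST': "S *v (T *v x) = x" "T *v (S *v x) = x" for x by (simp_all add: matrix_vector_mul_assoc ST)
  define H where "H p = T *v (G (S *v p) - w0)" for p
  interpret H: spectral_gap_map H "\<lambda>p. T ** A (S *v p) ** S" \<delta>
    unfolding H_def by (rule conjugate[OF ST])
  have transfer: "lift_on H (closed_segment x y) (\<lambda>w. T *v (\<phi> (S *v w + w0)))"
    if "lift_on G K \<phi>" "convex K" "S *v x + w0 \<in> K" "S *v y + w0 \<in> K" for x y \<phi> K
  proof -
    have inK: "S *v w + w0 \<in> K" if "w \<in> closed_segment x y" for w
    proof -
      obtain u where u: "0 \<le> u" "u \<le> 1" "w = (1 - u) *\<^sub>R x + u *\<^sub>R y" using \<open>w \<in> closed_segment x y\<close> by (auto simp: closed_segment_def)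
      have "S *v w + w0 = (1 - u) *\<^sub>R (S *v x + w0) + u *\<^sub>R (S *v y + w0)"
        unfolding u(3) by (simp add: matrix_vector_right_distrib matrix_vector_mult_scaleR algebra_simps)
      then show ?thesis using u \<open>convex K\<close> \<open>S *v x + w0 \<in> K\<close> \<open>S *v y + w0 \<in> K\<close> by (auto intro: convexD)
    qed
    have c: "continuous_on K \<phi>" and G: "\<And>w. w \<in> K \<Longrightarrow> G (\<phi> w) = w"
      using \<open>lift_on G K \<phi>\<close> by (auto simp: lift_on_def)
    have "continuous_on (closed_segment x y) (\<lambda>w. S *v w + w0)"
      by (intro continuous_on_add matrix_vector_mult_linear_continuous_on continuous_on_const)
    then have "continuous_on (closed_segment x y) (\<lambda>w. \<phi> (S *v w + w0))"
      by (rule continuous_on_compose2[OF c]) (use inK in blast)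
    then have "continuous_on (closed_segment x y) (\<lambda>w. T *v (\<phi> (S *v w + w0)))"
      by (rule continuous_on_compose2[OF matrix_vector_mult_linear_continuous_on[of UNIV]]) auto
    then show ?thesis
      unfolding lift_on_def H_def by (simp add: ST' G inK)
  qed
  have "\<exists>\<zeta>. lift_on H (closed_segment 0 (axis 2 1 - axis 1 1)) \<zeta> \<and> \<zeta> 0 = T *v (\<phi> (S *v 0 + w0))
    \<and> \<zeta> (axis 2 1 - axis 1 1) = T *v (\<psi>1 (S *v (axis 2 1 - axis 1 1) + w0))"
  proof (rule H.frame_lift_fills)
    show "lift_on H (closed_segment 0 (axis 2 1)) (\<lambda>w. T *v (\<phi> (S *v w + w0)))"
      by (rule transfer[OF \<phi>(1)]) (simp_all add: S2)
    show "lift_on H (closed_segment 0 (- 3 *\<^sub>R axis 1 1)) (\<lambda>w. T *v (\<psi>0 (S *v w + w0)))"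
      using d r \<psi>0(1) by (intro transfer[OF \<psi>0(2)]) (simp_all only: matrix_vector_mult_scaleR S1, simp_all add: dist_norm)
    show "lift_on H (closed_segment (axis 2 1) (axis 2 1 - 3 *\<^sub>R axis 1 1)) (\<lambda>w. T *v (\<psi>1 (S *v w + w0)))"
    proof (rule transfer[OF \<psi>1(2)])
      have "S *v (axis 2 1 - 3 *\<^sub>R axis 1 1) + w0 = w1 + 2 *\<^sub>R d"
        unfolding matrix_vector_mult_diff_distrib matrix_vector_mult_scaleR S1 S2
        by (simp add: d_def vec_eq_iff)
      then show "S *v (axis 2 1 - 3 *\<^sub>R axis 1 1) + w0 \<in> ball w1 r1"
        using d(1) r by (simp add: dist_norm)
      have "S *v axis 2 1 + w0 = w1 - d" by (simp add: S2 d_def)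
      then show "S *v axis 2 1 + w0 \<in> ball w1 r1" using d(1) r by (simp add: dist_norm)
    qed simp
  qed (simp_all add: S2 \<phi> \<psi>0 d)
  then obtain \<zeta> where \<zeta>: "lift_on H (closed_segment 0 (axis 2 1 - axis 1 1)) \<zeta>" "\<zeta> 0 = T *v p"
    "\<zeta> (axis 2 1 - axis 1 1) = T *v b"
    using \<phi>(2) \<psi>1(3) by (auto simp: matrix_vector_mult_diff_distrib S1 S2 d_def)
  define \<theta> where "\<theta> w = S *v (\<zeta> (T *v (w - w0)))" for w
  have Tw1: "T *v (w1 - w0) = axis 2 1 - axis 1 1"
  proof -
    have "w1 - w0 = S *v (axis 2 1 - axis 1 1)" by (simp add: matrix_vector_mult_diff_distrib S1 S2 d_def)
    then show ?thesis by (simp add: ST')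
  qed
  have seg: "T *v (w - w0) \<in> closed_segment 0 (axis 2 1 - axis 1 1)" if w: "w \<in> closed_segment w0 w1" for w
  proof -
    obtain u where u: "0 \<le> u" "u \<le> 1" "w = (1 - u) *\<^sub>R w0 + u *\<^sub>R w1" using w by (auto simp: closed_segment_def)
    have "w - w0 = u *\<^sub>R (w1 - w0)" unfolding u(3) by (simp add: algebra_simps)
    then have "T *v (w - w0) = u *\<^sub>R (axis 2 1 - axis 1 1)" by (simp add: matrix_vector_mult_scaleR Tw1)
    then show ?thesis using u by (auto simp: closed_segment_def)
  qed
  have "continuous_on (closed_segment w0 w1) (\<lambda>w. w - w0)" by (intro continuous_intros)
  then have "continuous_on (closed_segment w0 w1) (\<lambda>w. T *v (w - w0))"
    by (rule continuous_on_compose2[OF matrix_vector_mult_linear_continuous_on[of UNIV]]) auto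
  moreover have "continuous_on (closed_segment 0 (axis 2 1 - axis 1 1)) \<zeta>" using \<zeta>(1) by (simp add: lift_on_def)
  ultimately have "continuous_on (closed_segment w0 w1) (\<lambda>w. \<zeta> (T *v (w - w0)))"
    by (intro continuous_on_compose2[of _ \<zeta> "closed_segment w0 w1" "\<lambda>w. T *v (w - w0)"]) (use seg in blast)+
  then have "continuous_on (closed_segment w0 w1) \<theta>" unfolding \<theta>_def
    by (rule continuous_on_compose2[OF matrix_vector_mult_linear_continuous_on[of UNIV]]) auto
  moreover have "G (\<theta> w) = w" if "w \<in> closed_segment w0 w1" for w
  proof -
    have "H (\<zeta> (T *v (w - w0))) = T *v (w - w0)" using \<zeta>(1) seg[OF that] by (simp add: lift_on_def)
    then have "S *v (T *v (G (\<theta> w) - w0)) = S *v (T *v (w - w0))" by (simp add: H_def \<theta>_def)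
    then show ?thesis by (simp add: ST')
  qed
  ultimately have "lift_on G (closed_segment w0 w1) \<theta>" by (simp add: lift_on_def)
  moreover have "\<theta> w0 = p" "\<theta> w1 = b" by (simp_all add: \<theta>_def Tw1 \<zeta> ST')
  ultimately have "b \<in> segment_visible p" by (auto simp: segment_visible_def w0_def w1_def)
  then show False using b(2) by simp
qed

section \<open>The trace condition\<close>

text \<open>The map \<open>(t, x) \<mapsto> (t, F x - t (x - p))\<close> has a surjective derivative at \<open>(0, q)\<close>, hence covers a
  neighbourhood of \<open>(0, F q)\<close>. So for small \<open>t > 0\<close> the value \<open>F p = F q\<close> is attained near \<open>q\<close> by
  \<open>x \<mapsto> F x - t (x - p)\<close>, which also attains it at \<open>p\<close>.\<close>
lemma perturbation_not_injective:
  fixes F :: "'a::euclidean_space \<Rightarrow> 'a"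
  assumes cont: "continuous_on UNIV F" and F: "F p = F q" "p \<noteq> q"
    and deriv: "(F has_derivative F') (at q)" and inv: "bounded_linear R" "F' \<circ> R = id" and "0 < \<epsilon>"
  obtains t where "0 < t" "t < \<epsilon>" "\<not> inj (\<lambda>x. F x - t *\<^sub>R x)"
proof -
  define H :: "real \<times> 'a \<Rightarrow> real \<times> 'a" where "H v = (fst v, F (snd v) - fst v *\<^sub>R (snd v - p))" for v
  define H' :: "real \<times> 'a \<Rightarrow> real \<times> 'a" where "H' v = (fst v, F' (snd v) - fst v *\<^sub>R (q - p))" for v
  define K :: "real \<times> 'a \<Rightarrow> real \<times> 'a" where "K v = (fst v, R (snd v + fst v *\<^sub>R (q - p)))" for v
  define r where "r = min \<epsilon> (dist p q)"
  have r: "0 < r" using F assms(7) by (simp add: r_def)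
  have "H (0, q) \<in> interior (H ` ball (0, q) r)"
  proof (rule sussmann_open_mapping[of UNIV H _ H' K])
    show "continuous_on UNIV H" unfolding H_def
      by (intro continuous_intros continuous_on_compose2[OF cont]) auto
    have "((\<lambda>v. F (snd v)) has_derivative (\<lambda>v. F' (snd v))) (at (0 :: real, q))"
      using has_derivative_compose[OF has_derivative_snd[OF has_derivative_ident], of F F' "(0, q)" UNIV] deriv by simp
    then show "(H has_derivative H') (at (0, q))"
      unfolding H_def H'_def by (auto intro!: derivative_eq_intros)
    show "bounded_linear K" unfolding K_def
      by (intro bounded_linear_Pair bounded_linear_compose[OF inv(1)] bounded_linear_add
        bounded_linear_fst bounded_linear_snd bounded_linear_scaleR_const)
    show "H' \<circ> K = id" using inv(2) by (auto simp: fun_eq_iff H'_def K_def)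
    show "(0, q) \<in> interior (ball (0, q) r)" using r by (simp add: interior_open)
  qed auto
  then obtain e where e: "0 < e" "ball (0, F q) e \<subseteq> H ` ball (0, q) r"
    by (auto simp: mem_interior H_def)
  have "(e / 2, F q) \<in> ball (0, F q) e" using e(1) by (simp add: dist_Pair_Pair)
  then have "(e / 2, F q) \<in> H ` ball (0, q) r" using e(2) by blast
  then obtain v where "v \<in> ball (0, q) r" "(e / 2, F q) = H v" by blast
  then obtain t x where tx: "(t, x) \<in> ball (0, q) r" "(e / 2, F q) = H (t, x)" by (cases v) auto
  then have t: "t = e / 2" "F x - t *\<^sub>R (x - p) = F p" using F by (auto simp: H_def)
  have "dist (0, q) (t, x) < r" using tx by simp
  then have "\<bar>t\<bar> < r" "dist q x < r"
    using dist_fst_le[of "(0, q)" "(t, x)"] dist_snd_le[of "(0, q)" "(t, x)"] by (auto simp: dist_real_def)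
  then have "t < \<epsilon>" "x \<noteq> p" by (auto simp: r_def dist_commute)
  moreover have "F x - t *\<^sub>R x = F p - t *\<^sub>R p" using t(2) by (simp add: algebra_simps)
  ultimately have "\<not> inj (\<lambda>x. F x - t *\<^sub>R x)" by (auto simp: inj_def)
  then show ?thesis using that[of t] t(1) e(1) \<open>t < \<epsilon>\<close> by simp
qed

lemma C1_map_locally_injective:
  fixes G :: "real ^ 2 \<Rightarrow> real ^ 2"
  assumes deriv: "\<And>p. (G has_derivative (*v) (A p)) (at p)" and A: "continuous_on UNIV A" "det (A p) \<noteq> 0"
  shows "\<exists>e>0. inj_on G (ball p e)"
proof -
  obtain B where B: "B ** A p = mat 1"
    using A(2) invertible_det_nz invertible_left_inverse by blast
  show ?thesis
  proof (rule has_derivative_locally_injective[of p UNIV "(*v) B" "\<lambda>x. (*v) (A x)" G])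
    show "(*v) B \<circ> (*v) (A p) = id" by (auto simp: fun_eq_iff matrix_vector_mul_assoc B)
    show "\<exists>d>0. \<forall>x. dist p x < d \<longrightarrow> onorm (\<lambda>v. A x *v v - A p *v v) < e" if "0 < e" for e
    proof -
      obtain d where d: "0 < d" "\<And>x. dist x p < d \<Longrightarrow> dist (A x) (A p) < e / 8"
        using A(1) \<open>0 < e\<close> unfolding continuous_on_iff by (metis UNIV_I zero_less_divide_iff zero_less_numeral)
      have "onorm (\<lambda>v. A x *v v - A p *v v) < e" if "dist p x < d" for x
      proof -
        have "\<bar>(A x - A p) $ i $ j\<bar> \<le> e / 8" for i j
        proof -
          have "\<bar>(A x - A p) $ i $ j\<bar> \<le> norm ((A x - A p) $ i)" by (rule component_le_norm_cart)
          also have "\<dots> \<le> norm (A x - A p)" by (rule Finite_Cartesian_Product.norm_nth_le)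
          also have "\<dots> \<le> e / 8" using d(2)[of x] that by (simp add: dist_norm dist_commute norm_minus_commute)
          finally show ?thesis .
        qed
        then have "onorm ((*v) (A x - A p)) \<le> real CARD(2) * real CARD(2) * (e / 8)"
          by (rule onorm_le_matrix_component)
        moreover have "(\<lambda>v. A x *v v - A p *v v) = (*v) (A x - A p)"
          by (simp add: fun_eq_iff matrix_vector_mult_diff_rdistrib)
        ultimately show ?thesis using \<open>0 < e\<close> by simp
      qed
      then show ?thesis using d(1) by blast
    qed
  qed (use deriv in auto)
qed

text \<open>For \<open>0 < t < \<epsilon>\<close> the characteristic polynomial \<open>1 - s trace + s\<^sup>2\<close> is positive on \<open>[0, 2 t)\<close>. So
  \<open>F - t id\<close> has a spectral gap of radius \<open>t\<close>.\<close>
lemma injective_of_trace_bound: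
  fixes F :: "real ^ 2 \<Rightarrow> real ^ 2"
  assumes C1: "C1_map F" and det: "\<And>p. det (jacobian F (at p)) = 1"
    and tr: "\<And>p. trace (jacobian F (at p)) < c"
  shows "inj F"
proof (rule ccontr)
  assume "\<not> inj F"
  then obtain p q where pq: "p \<noteq> q" "F p = F q" by (auto simp: inj_def)
  define A where "A p = jacobian F (at p)" for p
  have dF: "(F has_derivative (*v) (A p)) (at p)" for p
    using C1 jacobian_works[of F "at p"] by (simp add: C1_map_def A_def)
  have contF: "continuous_on UNIV F"
    using dF has_derivative_continuous continuous_at_imp_continuous_on by blast
  have contA: "continuous_on UNIV A" using C1 by (simp add: C1_map_def A_def)
  define \<epsilon> where "\<epsilon> = 1 / (2 * max c 1)"
  have \<epsilon>: "0 < \<epsilon>" "2 * \<epsilon> * c \<le> 1" by (auto simp: \<epsilon>_def max_def field_simps)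
  have pos: "0 < det (A p - mat s)" if "0 \<le> s" "s < 2 * \<epsilon>" for p s
  proof -
    have "det (A p - mat s) = det (A p) - s * trace (A p) + s * s"
      by (simp add: det_2 trace_def sum_2 mat_def algebra_simps)
    moreover have "s * trace (A p) < 1 \<or> s = 0"
    proof (cases "s = 0")
      case False
      then have "s * trace (A p) < s * c" using that(1) tr[of p] by (simp add: A_def)
      also have "s * c \<le> 1"
      proof (cases "0 \<le> c")
        case True
        then have "s * c \<le> 2 * \<epsilon> * c" using that by (intro mult_right_mono) auto
        then show ?thesis using \<epsilon> by simp
      next
        case c: False
        then show ?thesis using mult_nonneg_nonpos[of s c] that(1) by simp
      qed
      finally show ?thesis by simp
    qed simp
    moreover have "0 \<le> s * s" by simp
    ultimately show ?thesis using det[of p] unfolding A_def by (elim disjE) (linarith, simp)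
  qed
  obtain R where R: "A q ** R = mat 1"
    using det[of q] invertible_det_nz[of "A q"] unfolding invertible_right_inverse A_def by auto
  obtain t where t: "0 < t" "t < \<epsilon>" "\<not> inj (\<lambda>x. F x - t *\<^sub>R x)"
  proof (rule perturbation_not_injective[OF contF pq(2,1) dF _ _ \<epsilon>(1)])
    show "(*v) (A q) \<circ> (*v) R = id" by (auto simp: fun_eq_iff matrix_vector_mul_assoc R)
  qed auto
  define G where "G x = F x - t *\<^sub>R x" for x
  have dG: "(G has_derivative (*v) (A p - mat t)) (at p)" for p
    unfolding G_def using dF[of p]
    by (auto intro!: derivative_eq_intros simp: matrix_vector_mult_diff_rdistrib mat_mult_vec)
  have "spectral_gap_map G (\<lambda>p. A p - mat t) t"
  proof
    show "continuous_on UNIV G" unfolding G_def by (intro continuous_intros contF)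
    show "\<exists>e>0. inj_on G (ball p e)" for p
      using pos[of t p] t by (intro C1_map_locally_injective[OF dG]) (auto intro!: continuous_intros contA)
    show "0 < det (A p - mat t)" for p using pos[of t p] t by simp
    show "det (A p - mat t - mat s) \<noteq> 0" if "\<bar>s\<bar> < t" for s p
    proof -
      have "A p - mat t - mat s = A p - mat (t + s)" by (simp add: vec_eq_iff mat_def)
      moreover have "0 < det (A p - mat (t + s))" using that t by (intro pos) auto
      ultimately show ?thesis by (metis less_irrefl)
    qed
  qed (use dG t in auto)
  then have "inj G" by (rule spectral_gap_map.injective)
  then show False using t(3) by (simp add: G_def[abs_def])
qed

theorem corollary5:
  fixes F :: "real ^ 2 \<Rightarrow> real ^ 2"
  assumes "C1_map F"
    and "\<forall>p. det (jacobian F (at p)) = 1"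
    and "\<not> surj (\<lambda>p. trace (jacobian F (at p)))"
  shows "inj F"
proof -
  define T where "T p = trace (jacobian F (at p))" for p
  have "continuous_on UNIV T"
    using assms(1) unfolding T_def trace_def C1_map_def by (intro continuous_intros) auto
  then have conn: "connected (range T)" by (intro connected_continuous_image) auto
  obtain c where c: "c \<notin> range T" using assms(3) unfolding T_def by auto
  have "(\<forall>p. T p < c) \<or> (\<forall>p. c < T p)"
    using conn c unfolding connected_iff_interval by (metis linorder_less_linear order_less_imp_le rangeI)
  then show ?thesis
  proof
    assume "\<forall>p. T p < c"
    then show ?thesis using assms by (intro injective_of_trace_bound[of F c]) (auto simp: T_def)
  next
    assume above: "\<forall>p. c < T p"
    have jac: "jacobian (\<lambda>x. - F x) (at p) = - jacobian F (at p)" for p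
    proof -
      have "(F has_derivative (*v) (jacobian F (at p))) (at p)"
        using assms(1) jacobian_works[of F "at p"] by (simp add: C1_map_def)
      then have "((\<lambda>x. - F x) has_derivative (*v) (- jacobian F (at p))) (at p)"
        by (auto intro!: derivative_eq_intros simp: fun_eq_iff matrix_vector_mult_2 vec_eq_iff)
      then show ?thesis
        unfolding jacobian_def by (simp add: frechet_derivative_at[symmetric])
    qed
    have "inj (\<lambda>x. - F x)"
    proof (rule injective_of_trace_bound[where c = "- c"])
      show "C1_map (\<lambda>x. - F x)"
        using assms(1) by (auto simp: C1_map_def jac intro!: continuous_intros derivative_intros)
      show "det (jacobian (\<lambda>x. - F x) (at p)) = 1" for p
        using assms(2) by (simp add: jac det_2)
      show "trace (jacobian (\<lambda>x. - F x) (at p)) < - c" for p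
        using above[rule_format, of p] by (simp add: jac T_def trace_def sum_negf)
    qed
    then show ?thesis by (auto simp: inj_def)
  qed
qed

end
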